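(* For every $n\ge 4$ the family $\mathcal{S}_n$ is generic in the variety of all $n$-dimensional complex commutative nilpotent algebras. Moreover, for every $n\ge 2$ this variety is irreducible and has dimension $\frac{n(n-1)(n+4)}{6}$.
   Context: All algebras are over $\mathbb{C}$, not necessarily associative. Fix an $n$-dimensional vector space with basis $e_1,\dots,e_n$; algebra structures are identified with points $(c_{ij}^k)\in\mathbb{C}^{n^3}$ of structure constants, $e_ie_j=\sum_k c_{ij}^ke_k$, with Zariski topology; $\mathrm{GL}_n(\mathbb{C})$ acts by change of basis and $O(\mathcal{A})$ denotes an orbit. An algebra $N$ is nilpotent if $N^k=0$ for some $k$, where $N^1=N$, $N^{k+1}=\sum_{i=1}^kN^iN^{k+1-i}$. A family $\mathcal{R}$ in an irreducible variety $\mathfrak{V}$ is generic if $\overline{\bigcup_{\mathcal{A}\in\mathcal{R}}O(\mathcal{A})}=\mathfrak{V}$. Condition ( * ): $c_{ij}^k=0$ whenever $k\le\max\{i,j\}$. For $n\ge4$, $\mathcal{S}_n$ is the family of commutative algebra structures satisfying ( * ) such that $e_i^2=e_{i+1}$ for $1\le i\le n-1$, $c_{23}^4=1$, $c_{12}^4\ne 0$, $c_{1i}^{i+1}=0$ for $2\le i\le n-1$, with all other structure constants arbitrary subject only to ( * ) and commutativity. *)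

theory Defs
  imports Complex_Main
begin

text \<open>Structure constants of an n-dimensional algebra with basis e_1..e_n:
  a point c of C^(n^3) is a function c i j k = c_{ij}^k, vanishing outside {1..n}^3.\<close>

type_synonym sc = "nat \<Rightarrow> nat \<Rightarrow> nat \<Rightarrow> complex"

definition ambient :: "nat \<Rightarrow> sc set" where
  "ambient n = {c. \<forall>i j k. \<not> (i \<in> {1..n} \<and> j \<in> {1..n} \<and> k \<in> {1..n}) \<longrightarrow> c i j k = 0}"

inductive_set poly_fun :: "nat \<Rightarrow> (sc \<Rightarrow> complex) set" for n :: nat where
  pf_const: "(\<lambda>c. a) \<in> poly_fun n"
| pf_coord: "i \<in> {1..n} \<Longrightarrow> j \<in> {1..n} \<Longrightarrow> k \<in> {1..n} \<Longrightarrow> (\<lambda>c. c i j k) \<in> poly_fun n"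
| pf_add: "f \<in> poly_fun n \<Longrightarrow> g \<in> poly_fun n \<Longrightarrow> (\<lambda>c. f c + g c) \<in> poly_fun n"
| pf_mult: "f \<in> poly_fun n \<Longrightarrow> g \<in> poly_fun n \<Longrightarrow> (\<lambda>c. f c * g c) \<in> poly_fun n"

definition zar_closed :: "nat \<Rightarrow> sc set \<Rightarrow> bool" where
  "zar_closed n Z \<longleftrightarrow> (\<exists>F. F \<subseteq> poly_fun n \<and> Z = {c \<in> ambient n. \<forall>f\<in>F. f c = 0})"

definition zar_closure :: "nat \<Rightarrow> sc set \<Rightarrow> sc set" where
  "zar_closure n X = \<Inter> {Z. zar_closed n Z \<and> X \<subseteq> Z}"

definition zar_irreducible :: "nat \<Rightarrow> sc set \<Rightarrow> bool" where
  "zar_irreducible n X \<longleftrightarrow> X \<noteq> {} \<and>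
     (\<forall>Z1 Z2. zar_closed n Z1 \<and> zar_closed n Z2 \<and> X \<subseteq> Z1 \<union> Z2 \<longrightarrow> X \<subseteq> Z1 \<or> X \<subseteq> Z2)"

definition irr_chain :: "nat \<Rightarrow> sc set \<Rightarrow> nat \<Rightarrow> (nat \<Rightarrow> sc set) \<Rightarrow> bool" where
  "irr_chain n X m Z \<longleftrightarrow>
     (\<forall>i\<le>m. zar_closed n (Z i) \<and> zar_irreducible n (Z i) \<and> Z i \<subseteq> X) \<and>
     (\<forall>i<m. Z i \<subset> Z (Suc i))"

definition zar_dim_is :: "nat \<Rightarrow> sc set \<Rightarrow> nat \<Rightarrow> bool" where
  "zar_dim_is n X d \<longleftrightarrow> (\<exists>Z. irr_chain n X d Z) \<and> (\<forall>m Z. irr_chain n X m Z \<longrightarrow> m \<le> d)"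

text \<open>Change of basis by an invertible matrix g (with inverse h): new basis e'_i = sum_p g_{pi} e_p.\<close>
definition inv_pair :: "nat \<Rightarrow> (nat \<Rightarrow> nat \<Rightarrow> complex) \<Rightarrow> (nat \<Rightarrow> nat \<Rightarrow> complex) \<Rightarrow> bool" where
  "inv_pair n g h \<longleftrightarrow> (\<forall>i\<in>{1..n}. \<forall>j\<in>{1..n}.
      (\<Sum>l\<in>{1..n}. g i l * h l j) = (if i = j then 1 else 0) \<and>
      (\<Sum>l\<in>{1..n}. h i l * g l j) = (if i = j then 1 else 0))"

definition act :: "nat \<Rightarrow> (nat \<Rightarrow> nat \<Rightarrow> complex) \<Rightarrow> (nat \<Rightarrow> nat \<Rightarrow> complex) \<Rightarrow> sc \<Rightarrow> sc" where
  "act n g h c = (\<lambda>i j k. if i \<in> {1..n} \<and> j \<in> {1..n} \<and> k \<in> {1..n} then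
      (\<Sum>p\<in>{1..n}. \<Sum>q\<in>{1..n}. \<Sum>r\<in>{1..n}. g p i * g q j * c p q r * h k r) else 0)"

definition orbit :: "nat \<Rightarrow> sc \<Rightarrow> sc set" where
  "orbit n c = {act n g h c | g h. inv_pair n g h}"

definition vecs :: "nat \<Rightarrow> (nat \<Rightarrow> complex) set" where
  "vecs n = {x. \<forall>k. k \<notin> {1..n} \<longrightarrow> x k = 0}"

definition amult :: "nat \<Rightarrow> sc \<Rightarrow> (nat \<Rightarrow> complex) \<Rightarrow> (nat \<Rightarrow> complex) \<Rightarrow> (nat \<Rightarrow> complex)" where
  "amult n c x y = (\<lambda>k. if k \<in> {1..n} then (\<Sum>i\<in>{1..n}. \<Sum>j\<in>{1..n}. x i * y j * c i j k) else 0)"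

text \<open>apow n c k x  means  x \<in> N^k, where N^1 = N and N^(k) = sum_{i+j=k} N^i N^j (as subspaces).\<close>
inductive apow :: "nat \<Rightarrow> sc \<Rightarrow> nat \<Rightarrow> (nat \<Rightarrow> complex) \<Rightarrow> bool" for n :: nat and c :: sc where
  ap_base: "x \<in> vecs n \<Longrightarrow> apow n c 1 x"
| ap_prod: "1 \<le> i \<Longrightarrow> 1 \<le> j \<Longrightarrow> apow n c i x \<Longrightarrow> apow n c j y \<Longrightarrow> apow n c (i + j) (amult n c x y)"
| ap_zero: "1 \<le> k \<Longrightarrow> apow n c k (\<lambda>_. 0)"
| ap_add: "apow n c k x \<Longrightarrow> apow n c k y \<Longrightarrow> apow n c k (\<lambda>l. x l + y l)"
| ap_smult: "apow n c k x \<Longrightarrow> apow n c k (\<lambda>l. a * x l)"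

definition nilpotent_alg :: "nat \<Rightarrow> sc \<Rightarrow> bool" where
  "nilpotent_alg n c \<longleftrightarrow> (\<exists>k\<ge>1. \<forall>x. apow n c k x \<longrightarrow> x = (\<lambda>_. 0))"

definition commutative_alg :: "sc \<Rightarrow> bool" where
  "commutative_alg c \<longleftrightarrow> (\<forall>i j k. c i j k = c j i k)"

definition CNil :: "nat \<Rightarrow> sc set" where
  "CNil n = {c \<in> ambient n. commutative_alg c \<and> nilpotent_alg n c}"

definition generic :: "nat \<Rightarrow> sc set \<Rightarrow> sc set \<Rightarrow> bool" where
  "generic n R V \<longleftrightarrow> zar_closure n (\<Union>c\<in>R. orbit n c) = V"

definition S_fam :: "nat \<Rightarrow> sc set" where
  "S_fam n = {c \<in> ambient n. commutative_alg c \<and>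
     (\<forall>i j k. k \<le> max i j \<longrightarrow> c i j k = 0) \<and>
     (\<forall>i\<in>{1..n-1}. \<forall>k. c i i k = (if k = i + 1 then 1 else 0)) \<and>
     c 2 3 4 = 1 \<and> c 1 2 4 \<noteq> 0 \<and>
     (\<forall>i\<in>{2..n-1}. c 1 i (i + 1) = 0)}"

end

theory Submission
  imports Defs "Jordan_Normal_Form.Determinant"
begin

text \<open>Every commutative nilpotent algebra has a basis adapted to a full flag, so \<open>CNil n\<close> is the
  \<open>GL\<close>-saturation of the linear space \<open>tri n\<close> of strictly triangular structures. As lower triangular
  matrices preserve \<open>tri n\<close>, the pairs of a unipotent upper triangular matrix and a point of \<open>tri n\<close>
  already parametrise a dense subset. This gives irreducibility, and the number of parameters bounds
  the dimension: a chain of length \<open>m\<close> yields \<open>m\<close> algebraically independent functions. Freeing the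
  parameters one at a time, in a suitable order, gives a chain of maximal length. Finally, a generic
  point of \<open>tri n\<close> is brought into \<open>S_fam n\<close> by a basis of iterated squares of a single vector.\<close>

section \<open>Function algebras and determinants\<close>

text \<open>The parametrisation must be polynomial on an affine space, which the inverse of a
  general matrix is not. A unipotent matrix has determinant 1, so its inverse is its adjugate; this
  restriction also divides out the lower triangular matrices, which would be counted twice. The
  price is that matrices without a triangular factorisation are reached only in the closure.

  All density claims are settled alike: the given point is joined by a line to a point satisfying an
  open condition, and two nonzero polynomials in one variable have a common point of nonvanishing.

  As the dimension is defined by chains of irreducible closed sets, both bounds need an argument.
  The upper one compares the growth of two spaces of monomials. For the lower one, each parameter
  needs a polynomial that vanishes while this parameter and all later ones are 0, but not once it is
  released.

  The number is n(n-1)(n+1)/6 structure constants plus n(n-1)/2 matrix entries. Closedness of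
  \<open>CNil n\<close> rests on a nilpotency bound that depends on n alone.\<close>

locale fun_alg =
  fixes C :: "('a \<Rightarrow> complex) set"
  assumes const: "(\<lambda>x. a) \<in> C"
    and add: "f \<in> C \<Longrightarrow> g \<in> C \<Longrightarrow> (\<lambda>x. f x + g x) \<in> C"
    and mult: "f \<in> C \<Longrightarrow> g \<in> C \<Longrightarrow> (\<lambda>x. f x * g x) \<in> C"
begin

lemma uminus: "f \<in> C \<Longrightarrow> (\<lambda>x. - f x) \<in> C"
  using mult[OF const[of "-1"], of f] by simp

lemma diff: "f \<in> C \<Longrightarrow> g \<in> C \<Longrightarrow> (\<lambda>x. f x - g x) \<in> C"
  using add[OF _ uminus, of f g] by simp

lemma sum: "(\<And>i. i \<in> I \<Longrightarrow> F i \<in> C) \<Longrightarrow> (\<lambda>x. \<Sum>i\<in>I. F i x) \<in> C"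
  by (induction I rule: infinite_finite_induct) (auto intro: const add)

lemma prod: "(\<And>i. i \<in> I \<Longrightarrow> F i \<in> C) \<Longrightarrow> (\<lambda>x. \<Prod>i\<in>I. F i x) \<in> C"
  by (induction I rule: infinite_finite_induct) (auto intro: const mult)

lemma power: "f \<in> C \<Longrightarrow> (\<lambda>x. f x ^ k) \<in> C"
  by (induction k) (auto intro: const mult)

lemma det:
  assumes "\<And>i j. i < n \<Longrightarrow> j < n \<Longrightarrow> (\<lambda>x. A x i j) \<in> C"
  shows "(\<lambda>x. det (mat n n (\<lambda>(i,j). A x i j))) \<in> C"
proof -
  have *: "det (mat n n (\<lambda>(i,j). A x i j)) =
     (\<Sum>p | p permutes {0..<n}. signof p * (\<Prod>i = 0..<n. A x i (p i)))" for x
    by (auto simp: det_def permutes_in_image intro!: sum.cong prod.cong)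
  show ?thesis
    unfolding * by (intro sum mult const prod assms) (auto simp: permutes_in_image)
qed

text \<open>Pulls polynomials in the structure constants back to a line (\<open>upoly\<close>) or to
  the parameter space (\<open>mpoly\<close>).\<close>

lemma poly_fun_comp:
  assumes "f \<in> poly_fun n"
    and "\<And>i j k. i \<in> {1..n} \<Longrightarrow> j \<in> {1..n} \<Longrightarrow> k \<in> {1..n} \<Longrightarrow> (\<lambda>x. \<phi> x i j k) \<in> C"
  shows "(\<lambda>x. f (\<phi> x)) \<in> C"
  using assms(1) by induction (auto intro: assms(2) const add mult)

lemma act:
  assumes "\<And>i j. i \<in> {1..n} \<Longrightarrow> j \<in> {1..n} \<Longrightarrow> (\<lambda>x. g x i j) \<in> C"
    and "\<And>i j. i \<in> {1..n} \<Longrightarrow> j \<in> {1..n} \<Longrightarrow> (\<lambda>x. h x i j) \<in> C"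
    and "\<And>i j k. i \<in> {1..n} \<Longrightarrow> j \<in> {1..n} \<Longrightarrow> k \<in> {1..n} \<Longrightarrow> (\<lambda>x. c x i j k) \<in> C"
  shows "(\<lambda>x. act n (g x) (h x) (c x) i j k) \<in> C"
proof (cases "i \<in> {1..n} \<and> j \<in> {1..n} \<and> k \<in> {1..n}")
  case True
  then show ?thesis
    unfolding act_def by (simp only: if_True simp_thms) (intro sum mult assms; simp)
next
  case False
  have "act n g h c i j k = 0" for g h c
    using False unfolding act_def by auto
  then show ?thesis by (simp add: const)
qed

end

lemma fun_alg_poly_fun: "fun_alg (poly_fun n)"
  by unfold_locales (auto intro: poly_fun.intros)

definition upoly :: "(complex \<Rightarrow> complex) set" where
  "upoly = range poly"

lemma fun_alg_upoly: "fun_alg upoly"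
proof
  fix f g assume fg: "f \<in> upoly" "g \<in> upoly"
  then obtain p q where [simp]: "f = poly p" "g = poly q" unfolding upoly_def by auto
  show "(\<lambda>x. f x + g x) \<in> upoly" 
    unfolding upoly_def by (rule range_eqI[of _ _ "p+q"]) auto
  show "(\<lambda>x. f x * g x) \<in> upoly" 
    unfolding upoly_def by (rule range_eqI[of _ _ "p*q"]) auto
next
  fix a :: complex
  show "(\<lambda>x. a) \<in> upoly"
    unfolding upoly_def by (rule range_eqI[of _ _ "[:a:]"]) auto
qed

lemma upoly_id: "(\<lambda>s. s) \<in> upoly"
  unfolding upoly_def by (rule range_eqI[of _ _ "[:0,1:]"]) auto

text \<open>The form in which lines are used: f and g may be known to be nonzero only at different
  points a and b, and a common point s results.\<close>

lemma upoly_no_zero_divisors: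
  assumes "f \<in> upoly" "g \<in> upoly" "f a \<noteq> 0" "g b \<noteq> 0"
  obtains s where "f s \<noteq> 0" "g s \<noteq> 0"
proof -
  obtain p q where pq: "f = poly p" "g = poly q" using assms unfolding upoly_def by auto
  with assms have "p * q \<noteq> 0" by auto
  then obtain s where "poly (p * q) s \<noteq> 0" by (metis poly_all_0_iff_0)
  then show ?thesis using that pq by auto
qed

section \<open>Determinants and adjugates with indices starting from 1\<close>

definition fmat :: "nat \<Rightarrow> (nat \<Rightarrow> nat \<Rightarrow> complex) \<Rightarrow> complex mat" where
  "fmat n A = mat n n (\<lambda>(i,j). A (Suc i) (Suc j))"

definition fdet :: "nat \<Rightarrow> (nat \<Rightarrow> nat \<Rightarrow> complex) \<Rightarrow> complex" where
  "fdet n A = det (fmat n A)"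

text \<open>The adjugate: cofactors with transposed indices. It replaces the inverse wherever
  polynomial dependence on the matrix matters.\<close>

definition fadj :: "nat \<Rightarrow> (nat \<Rightarrow> nat \<Rightarrow> complex) \<Rightarrow> nat \<Rightarrow> nat \<Rightarrow> complex" where
  "fadj n A i j = cofactor (fmat n A) (j - 1) (i - 1)"

context fun_alg
begin

lemma fdet:
  assumes "\<And>i j. i \<in> {1..n} \<Longrightarrow> j \<in> {1..n} \<Longrightarrow> (\<lambda>x. A x i j) \<in> C"
  shows "(\<lambda>x. fdet n (A x)) \<in> C"
  unfolding fdet_def fmat_def by (intro det assms) auto

lemma fadj:
  assumes "\<And>i j. i \<in> {1..n} \<Longrightarrow> j \<in> {1..n} \<Longrightarrow> (\<lambda>x. A x i j) \<in> C"
  shows "(\<lambda>x. fadj n (A x) i j) \<in> C"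
proof -
  have "mat_delete (fmat n A) a b = mat (n - 1) (n - 1)
     (\<lambda>(i,j). A (Suc (if i < a then i else Suc i)) (Suc (if j < b then j else Suc j)))" for A a b
    unfolding mat_delete_def fmat_def by (rule eq_matI) auto
  then show ?thesis
    unfolding fadj_def cofactor_def
    by (simp only:) (intro mult const det assms; auto)
qed

end

lemma sum_1_n_shift: "(\<Sum>l\<in>{1..n}. f l) = (\<Sum>l\<in>{0..<n}. f (Suc l))"
  by (rule sum.reindex_bij_witness[of _ Suc "\<lambda>i. i - 1"]) auto

lemma fmat_carrier [simp]: "fmat n A \<in> carrier_mat n n"
  by (simp add: fmat_def)

lemma fadj_mult:
  assumes "i \<in> {1..n}" "j \<in> {1..n}"
  shows "(\<Sum>l\<in>{1..n}. A i l * fadj n A l j) = (if i = j then fdet n A else 0)" (is ?t1)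
    and "(\<Sum>l\<in>{1..n}. fadj n A i l * A l j) = (if i = j then fdet n A else 0)" (is ?t2)
proof -
  let ?A = "fmat n A"
  have 1: "(?A * adj_mat ?A) $$ (i-1,j-1) = (det ?A \<cdot>\<^sub>m 1\<^sub>m n) $$ (i-1,j-1)"
    using adj_mat(2)[of ?A n] by simp
  have 2: "(adj_mat ?A * ?A) $$ (i-1,j-1) = (det ?A \<cdot>\<^sub>m 1\<^sub>m n) $$ (i-1,j-1)"
    using adj_mat(3)[of ?A n] by simp
  have d: "dim_row ?A = n" "dim_col ?A = n" by (auto simp: fmat_def)
  have ij: "i - 1 < n" "j - 1 < n" "i - 1 = j - 1 \<longleftrightarrow> i = j" using assms by auto
  have e: "adj_mat ?A \<in> carrier_mat n n" by (simp add: adj_mat(1))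
  then have e': "dim_row (adj_mat ?A) = n" "dim_col (adj_mat ?A) = n" by auto
  have "(?A * adj_mat ?A) $$ (i-1,j-1) = (\<Sum>l\<in>{0..<n}. ?A $$ (i-1,l) * adj_mat ?A $$ (l, j-1))"
    using ij e' d by (simp add: scalar_prod_def)
  also have "\<dots> = (\<Sum>l\<in>{0..<n}. A i (Suc l) * fadj n A (Suc l) j)"
    using assms by (intro sum.cong) (auto simp: fmat_def adj_mat_def fadj_def)
  finally show ?t1 unfolding sum_1_n_shift fdet_def using 1 ij by simp
  have "(adj_mat ?A * ?A) $$ (i-1,j-1) = (\<Sum>l\<in>{0..<n}. adj_mat ?A $$ (i-1,l) * ?A $$ (l, j-1))"
    using ij e' d by (simp add: scalar_prod_def)
  also have "\<dots> = (\<Sum>l\<in>{0..<n}. fadj n A i (Suc l) * A (Suc l) j)"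
    using assms by (intro sum.cong) (auto simp: fmat_def adj_mat_def fadj_def)
  finally show ?t2 unfolding sum_1_n_shift fdet_def using 2 ij by simp
qed

lemma fdet_eq_0_iff:
  "fdet n A = 0 \<longleftrightarrow>
    (\<exists>v\<in>vecs n. v \<noteq> (\<lambda>_. 0) \<and> (\<forall>i\<in>{1..n}. (\<Sum>j\<in>{1..n}. A i j * v j) = 0))"
proof -
  have "fdet n A = 0 \<longleftrightarrow> (\<exists>v\<in>carrier_vec n. v \<noteq> 0\<^sub>v n \<and> fmat n A *\<^sub>v v = 0\<^sub>v n)"
    unfolding fdet_def using det_0_iff_vec_prod_zero[of "fmat n A" n] by auto
  also have "\<dots> \<longleftrightarrow> (\<exists>v\<in>vecs n. v \<noteq> (\<lambda>_. 0) \<and> (\<forall>i\<in>{1..n}. (\<Sum>j\<in>{1..n}. A i j * v j) = 0))"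
  proof (intro iffI; elim bexE conjE)
    fix v assume v: "v \<in> carrier_vec n" "v \<noteq> 0\<^sub>v n" "fmat n A *\<^sub>v v = 0\<^sub>v n"
    let ?w = "\<lambda>i. if i \<in> {1..n} then v $ (i - 1) else 0"
    obtain k where k: "k < n" "v $ k \<noteq> 0"
      using v(1,2) by (metis carrier_vecD eq_vecI index_zero_vec(1,2))
    have "?w (Suc k) \<noteq> 0" using k by simp
    then have "?w \<noteq> (\<lambda>_. 0)" by metis
    moreover have "(\<Sum>j\<in>{1..n}. A i j * ?w j) = 0" if "i \<in> {1..n}" for i
    proof -
      have "(fmat n A *\<^sub>v v) $ (i - 1) = 0" using v(3) that by auto
      moreover have "(fmat n A *\<^sub>v v) $ (i - 1) = (\<Sum>j\<in>{0..<n}. A i (Suc j) * v $ j)"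
        using that v(1) by (auto simp: fmat_def scalar_prod_def)
      ultimately show ?thesis unfolding sum_1_n_shift by simp
    qed
    moreover have "?w \<in> vecs n" by (auto simp: vecs_def)
    ultimately show "\<exists>v\<in>vecs n. v \<noteq> (\<lambda>_. 0) \<and> (\<forall>i\<in>{1..n}. (\<Sum>j\<in>{1..n}. A i j * v j) = 0)"
      by blast
  next
    fix v assume v: "v \<in> vecs n" "v \<noteq> (\<lambda>_. 0)" "\<forall>i\<in>{1..n}. (\<Sum>j\<in>{1..n}. A i j * v j) = 0"
    let ?w = "Matrix.vec n (\<lambda>i. v (Suc i))"
    obtain k where k: "v k \<noteq> 0" using v(2) by auto
    with v(1) have k': "k \<in> {1..n}" by (auto simp: vecs_def)
    with k have "?w $ (k - 1) \<noteq> 0\<^sub>v n $ (k - 1)" by auto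
    then have "?w \<noteq> 0\<^sub>v n" by metis
    moreover have "fmat n A *\<^sub>v ?w = 0\<^sub>v n"
    proof (rule eq_vecI)
      fix i assume i: "i < dim_vec (0\<^sub>v n :: complex Matrix.vec)"
      then have "(\<Sum>j\<in>{1..n}. A (Suc i) j * v j) = 0" using v(3) by auto
      then show "(fmat n A *\<^sub>v ?w) $ i = 0\<^sub>v n $ i"
        unfolding sum_1_n_shift using i by (simp add: fmat_def scalar_prod_def)
    qed (simp add: fmat_def)
    ultimately show "\<exists>v\<in>carrier_vec n. v \<noteq> 0\<^sub>v n \<and> fmat n A *\<^sub>v v = 0\<^sub>v n"
      by (intro bexI[of _ ?w]) auto
  qed
  finally show ?thesis .
qed

section \<open>Algebraic dependence and chains of irreducible sets\<close>

text \<open>The domain is left arbitrary: it is a parameter space in the dimension bound, and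
  \<open>nat\<close> when the functions are the vectors of an algebra.\<close>

inductive_set lspan :: "('a \<Rightarrow> complex) set \<Rightarrow> ('a \<Rightarrow> complex) set" for B where
  lspan_zero: "(\<lambda>_. 0) \<in> lspan B"
| lspan_step: "f \<in> lspan B \<Longrightarrow> b \<in> B \<Longrightarrow> (\<lambda>x. f x + a * b x) \<in> lspan B"

lemma lspan_superset: "b \<in> B \<Longrightarrow> b \<in> lspan B"
  using lspan_step[OF lspan_zero, of b B 1] by simp

lemma lspan_add: "f \<in> lspan B \<Longrightarrow> g \<in> lspan B \<Longrightarrow> (\<lambda>x. f x + g x) \<in> lspan B"
proof (induction f rule: lspan.induct)
  case (lspan_step f b a)
  have "(\<lambda>x. (f x + g x) + a * b x) \<in> lspan B"
    using lspan_step by (auto intro: lspan.lspan_step)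
  then show ?case by (simp add: algebra_simps)
qed simp

lemma lspan_smult: "f \<in> lspan B \<Longrightarrow> (\<lambda>x. a * f x) \<in> lspan B"
proof (induction rule: lspan.induct)
  case (lspan_step f b a')
  then have "(\<lambda>x. a * f x + (a * a') * b x) \<in> lspan B"
    by (auto intro: lspan.lspan_step)
  then show ?case by (simp add: algebra_simps)
qed (simp add: lspan_zero)

lemma lspan_mono: "f \<in> lspan B \<Longrightarrow> B \<subseteq> B' \<Longrightarrow> f \<in> lspan B'"
  by (induction rule: lspan.induct) (auto intro: lspan.intros)

lemma lspan_sum: "(\<And>i. i \<in> I \<Longrightarrow> F i \<in> lspan B) \<Longrightarrow> (\<lambda>x. \<Sum>i\<in>I. F i x) \<in> lspan B"
  by (induction I rule: infinite_finite_induct) (auto intro: lspan_zero lspan_add)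

lemma lspan_mult:
  assumes "f \<in> lspan A" "g \<in> lspan B"
    and "\<And>a b. a \<in> A \<Longrightarrow> b \<in> B \<Longrightarrow> (\<lambda>x. a x * b x) \<in> lspan D"
  shows "(\<lambda>x. f x * g x) \<in> lspan D"
  using assms(1)
proof induction
  case (lspan_step f a r)
  have "(\<lambda>x. a x * g x) \<in> lspan D"
    using assms(2)
  proof induction
    case (lspan_step g b r)
    then show ?case
      using lspan_add[OF lspan_step(3) lspan_smult[OF assms(3)[of a b], of r]] \<open>a \<in> A\<close>
      by (simp add: algebra_simps)
  qed (simp add: lspan_zero)
  from lspan_add[OF lspan_step(3) lspan_smult[OF this, of r]]
  show ?case by (simp add: algebra_simps)
qed (simp add: lspan_zero)

lemma lspan_finite_coeffs:
  assumes "finite B" "f \<in> lspan B"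
  shows "\<exists>c. f = (\<lambda>x. \<Sum>b\<in>B. c b * b x)"
  using assms(2)
proof induction
  case lspan_zero
  show ?case by (rule exI[of _ "\<lambda>_. 0"]) simp
next
  case (lspan_step f b a)
  then obtain c where c: "f = (\<lambda>x. \<Sum>b\<in>B. c b * b x)" by blast
  have "f x + a * b x = (\<Sum>b'\<in>B. (c b' + (if b' = b then a else 0)) * b' x)" for x
  proof -
    have "(\<Sum>b'\<in>B. (if b' = b then a else 0) * b' x) = (\<Sum>b'\<in>B. if b' = b then a * b' x else 0)"
      by (intro sum.cong) auto
    also have "\<dots> = a * b x" using lspan_step assms(1) by simp
    finally show ?thesis unfolding c distrib_right sum.distrib by simp
  qed
  then show ?case by (intro exI[of _ "\<lambda>b'. c b' + (if b' = b then a else 0)"] ext)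
qed

lemma underdetermined_system:
  fixes A :: "nat \<Rightarrow> nat \<Rightarrow> complex"
  assumes "M < N"
  shows "\<exists>v\<in>vecs N. v \<noteq> (\<lambda>_. 0) \<and> (\<forall>i\<in>{1..M}. (\<Sum>j\<in>{1..N}. A i j * v j) = 0)"
proof -
  \<comment> \<open>Zero rows make the system square. As M < N, row M (counted from 0) is zero, so
    every term of the Leibniz formula has a zero factor.\<close>
  let ?A = "\<lambda>i j. if i \<le> M then A i j else 0"
  have "det (fmat N ?A) = 0"
  proof -
    have *: "(\<Prod>i = 0..<N. fmat N ?A $$ (i, p i)) = 0" if "p permutes {0..<N}" for p
    proof (rule prod_zero)
      have "p M < N" using that assms permutes_in_image[OF that, of M] by simp
      then show "\<exists>i\<in>{0..<N}. fmat N ?A $$ (i, p i) = 0"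
        using assms by (intro bexI[of _ M]) (auto simp: fmat_def)
    qed simp
    show ?thesis
      unfolding det_def'[OF fmat_carrier]
      by (rule sum.neutral, rule ballI, subst *) (simp_all only: mem_Collect_eq mult_zero_right)
  qed
  then obtain v where v: "v \<in> vecs N" "v \<noteq> (\<lambda>_. 0)" "\<forall>i\<in>{1..N}. (\<Sum>j\<in>{1..N}. ?A i j * v j) = 0"
    using fdet_eq_0_iff[of N ?A] unfolding fdet_def by blast
  have "(\<Sum>j\<in>{1..N}. A i j * v j) = 0" if "i \<in> {1..M}" for i
    using v(3)[rule_format, of i] that assms by simp
  with v show ?thesis by blast
qed

text \<open>Coordinates with respect to B turn the relation into card B linear equations in card A
  unknowns. The family is indexed, not a set, so that equal functions at two indices count as
  dependent; distinct exponent lists may give equal functions in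
  \<open>algebraic_dependence\<close>.\<close>

lemma lspan_dependent:
  assumes "finite B" "finite A" "card B < card A" "\<And>a. a \<in> A \<Longrightarrow> F a \<in> lspan B"
  shows "\<exists>v. (\<exists>a\<in>A. v a \<noteq> 0) \<and> (\<forall>x. (\<Sum>a\<in>A. v a * F a x) = 0)"
proof -
  have "\<forall>a\<in>A. \<exists>c. F a = (\<lambda>x. \<Sum>b\<in>B. c b * b x)"
    using lspan_finite_coeffs[OF assms(1)] assms(4) by blast
  then obtain c where c: "\<And>a. a \<in> A \<Longrightarrow> F a = (\<lambda>x. \<Sum>b\<in>B. c a b * b x)"
    by metis
  obtain \<alpha> where \<alpha>: "bij_betw \<alpha> {1..card A} A" using assms(2) ex_bij_betw_nat_finite_1 by blast
  obtain \<beta> where \<beta>: "bij_betw \<beta> {1..card B} B" using assms(1) ex_bij_betw_nat_finite_1 by blast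
  obtain w where w: "w \<in> vecs (card A)" "w \<noteq> (\<lambda>_. 0)"
    "\<And>i. i \<in> {1..card B} \<Longrightarrow> (\<Sum>j\<in>{1..card A}. c (\<alpha> j) (\<beta> i) * w j) = 0"
    using underdetermined_system[OF assms(3), of "\<lambda>i j. c (\<alpha> j) (\<beta> i)"] by blast
  define v where "v a = w (inv_into {1..card A} \<alpha> a)" for a
  have v\<alpha>: "v (\<alpha> j) = w j" if "j \<in> {1..card A}" for j
    using that \<alpha> by (simp add: v_def bij_betw_inv_into_left)
  have 1: "(\<Sum>a\<in>A. v a * c a b) = 0" if b: "b \<in> B" for b
  proof -
    obtain i where i: "i \<in> {1..card B}" "b = \<beta> i" using b bij_betw_imp_surj_on[OF \<beta>] by blast
    have "(\<Sum>a\<in>A. v a * c a b) = (\<Sum>j\<in>{1..card A}. v (\<alpha> j) * c (\<alpha> j) b)"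
      using sum.reindex_bij_betw[OF \<alpha>, of "\<lambda>a. v a * c a b"] by simp
    also have "\<dots> = (\<Sum>j\<in>{1..card A}. c (\<alpha> j) (\<beta> i) * w j)"
      using i v\<alpha> by (intro sum.cong) auto
    finally show ?thesis using w(3) i by simp
  qed
  have 2: "(\<Sum>a\<in>A. v a * F a x) = 0" for x
  proof -
    have "(\<Sum>a\<in>A. v a * F a x) = (\<Sum>a\<in>A. \<Sum>b\<in>B. v a * c a b * b x)"
      using c by (intro sum.cong) (auto simp: sum_distrib_left mult.assoc)
    also have "\<dots> = (\<Sum>b\<in>B. \<Sum>a\<in>A. v a * c a b * b x)"
      by (rule sum.swap)
    also have "\<dots> = (\<Sum>b\<in>B. (\<Sum>a\<in>A. v a * c a b) * b x)"
      by (simp add: sum_distrib_right)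
    finally show ?thesis using 1 by simp
  qed
  obtain j where "w j \<noteq> 0" using w(2) by auto
  with w(1) have j: "j \<in> {1..card A}" by (auto simp: vecs_def)
  then have "\<alpha> j \<in> A" using \<alpha> by (auto simp: bij_betw_def)
  with v\<alpha>[OF j] \<open>w j \<noteq> 0\<close> 2 show ?thesis by metis
qed

section \<open>Polynomial functions in several variables and their monomials\<close>

inductive_set mpoly :: "'v set \<Rightarrow> (('v \<Rightarrow> complex) \<Rightarrow> complex) set" for V :: "'v set" where
  mp_const: "(\<lambda>x. a) \<in> mpoly V"
| mp_var: "v \<in> V \<Longrightarrow> (\<lambda>x. x v) \<in> mpoly V"
| mp_add: "f \<in> mpoly V \<Longrightarrow> g \<in> mpoly V \<Longrightarrow> (\<lambda>x. f x + g x) \<in> mpoly V"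
| mp_mult: "f \<in> mpoly V \<Longrightarrow> g \<in> mpoly V \<Longrightarrow> (\<lambda>x. f x * g x) \<in> mpoly V"

lemma fun_alg_mpoly: "fun_alg (mpoly V)"
  by unfold_locales (auto intro: mpoly.intros)

lemma mpoly_line:
  "f \<in> mpoly V \<Longrightarrow> (\<lambda>s. f (\<lambda>v. x v + s * (y v - x v))) \<in> upoly"
proof -
  interpret fun_alg upoly by (rule fun_alg_upoly)
  show "f \<in> mpoly V \<Longrightarrow> (\<lambda>s. f (\<lambda>v. x v + s * (y v - x v))) \<in> upoly"
    by (induction rule: mpoly.induct) (auto intro!: const add mult diff upoly_id)
qed

text \<open>Restriction to the line through x and y reduces this to one variable.\<close>

lemma mpoly_no_zero_divisors:
  assumes "f \<in> mpoly V" "g \<in> mpoly V" "f x \<noteq> 0" "g y \<noteq> 0"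
  shows "\<exists>z. f z \<noteq> 0 \<and> g z \<noteq> 0"
  by (rule upoly_no_zero_divisors[OF mpoly_line[OF assms(1), of x y] mpoly_line[OF assms(2), of x y],
      of 0 1]) (use assms(3,4) in auto)

text \<open>Each exponent is bounded separately, rather than the total degree: the bound (D + 1) ^
  card V on their number is then immediate, and bounds add under multiplication.\<close>

definition box_monomials :: "'v set \<Rightarrow> nat \<Rightarrow> (('v \<Rightarrow> complex) \<Rightarrow> complex) set" where
  "box_monomials V D = (\<lambda>\<alpha> x. \<Prod>v\<in>V. x v ^ \<alpha> v) ` (V \<rightarrow>\<^sub>E {..D})"

lemma box_monomialsI:
  assumes "\<And>v. v \<in> V \<Longrightarrow> \<alpha> v \<le> D" "\<And>x. f x = (\<Prod>v\<in>V. x v ^ \<alpha> v)"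
  shows "f \<in> box_monomials V D"
  unfolding box_monomials_def
  by (rule image_eqI[of _ _ "restrict \<alpha> V"]) (use assms in \<open>auto intro!: prod.cong\<close>)

lemma box_monomialsE:
  assumes "f \<in> box_monomials V D"
  obtains \<alpha> where "\<And>v. v \<in> V \<Longrightarrow> \<alpha> v \<le> D" "f = (\<lambda>x. \<Prod>v\<in>V. x v ^ \<alpha> v)"
  using assms unfolding box_monomials_def by (elim imageE) (auto simp: PiE_iff)

lemma box_monomials_finite: "finite V \<Longrightarrow> finite (box_monomials V D)"
  unfolding box_monomials_def by (intro finite_imageI finite_PiE) auto

lemma box_monomials_card: "finite V \<Longrightarrow> card (box_monomials V D) \<le> (D + 1) ^ card V"
  unfolding box_monomials_def
  by (rule order_trans[OF card_image_le]) (auto intro: finite_PiE simp: card_PiE)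

lemma box_monomials_mono: "D \<le> D' \<Longrightarrow> box_monomials V D \<subseteq> box_monomials V D'"
  by (blast elim: box_monomialsE intro: box_monomialsI order_trans)

lemma box_monomials_mult:
  assumes "f \<in> box_monomials V D" "g \<in> box_monomials V E"
  shows "(\<lambda>x. f x * g x) \<in> box_monomials V (D + E)"
proof -
  obtain \<alpha> \<beta> where "\<And>v. v \<in> V \<Longrightarrow> \<alpha> v \<le> D" "f = (\<lambda>x. \<Prod>v\<in>V. x v ^ \<alpha> v)"
     "\<And>v. v \<in> V \<Longrightarrow> \<beta> v \<le> E" "g = (\<lambda>x. \<Prod>v\<in>V. x v ^ \<beta> v)"
    using assms by (auto elim!: box_monomialsE)
  then show ?thesis
    by (intro box_monomialsI[of V "\<lambda>v. \<alpha> v + \<beta> v"])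
      (simp_all add: power_add prod.distrib add_mono)
qed

lemma lspan_box_mult:
  assumes "f \<in> lspan (box_monomials V D)" "g \<in> lspan (box_monomials V E)"
  shows "(\<lambda>x. f x * g x) \<in> lspan (box_monomials V (D + E))"
  using assms by (rule lspan_mult) (auto intro: lspan_superset box_monomials_mult)

lemma one_in_lspan_box: "(\<lambda>x. 1) \<in> lspan (box_monomials V 0)"
  by (intro lspan_superset box_monomialsI[of V "\<lambda>_. 0"]) auto

lemma lspan_box_power:
  assumes "f \<in> lspan (box_monomials V D)"
  shows "(\<lambda>x. f x ^ k) \<in> lspan (box_monomials V (k * D))"
proof (induction k)
  case (Suc k)
  then show ?case using lspan_box_mult[OF assms Suc] by simp
qed (simp add: one_in_lspan_box)

lemma mpoly_in_lspan_box:
  assumes "finite V" "f \<in> mpoly V"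
  shows "\<exists>D. f \<in> lspan (box_monomials V D)"
  using assms(2)
proof induction
  case (mp_const a)
  show ?case using lspan_smult[OF one_in_lspan_box, of a V] by auto
next
  case (mp_var v)
  have "(\<lambda>x. x v) \<in> box_monomials V 1"
  proof (rule box_monomialsI[of V "\<lambda>w. if w = v then 1 else 0"])
    fix x :: "'a \<Rightarrow> complex"
    show "x v = (\<Prod>w\<in>V. x w ^ (if w = v then 1 else 0))"
      using mp_var assms(1) by (simp add: if_distrib prod.delta cong: if_cong)
  qed auto
  then show ?case by (blast intro: lspan_superset)
next
  case (mp_add f g)
  then obtain D E where "f \<in> lspan (box_monomials V D)" "g \<in> lspan (box_monomials V E)" by blast
  then have "(\<lambda>x. f x + g x) \<in> lspan (box_monomials V (D + E))"
    by (intro lspan_add) (erule lspan_mono, simp add: box_monomials_mono)+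
  then show ?case by blast
next
  case (mp_mult f g)
  then show ?case using lspan_box_mult by blast
qed

text \<open>The head of the list is the exponent of the function with the largest index, so that the
  induction in \<open>irr_chain_independent\<close> can split off g m, which belongs to the top step
  of the chain.\<close>

primrec lmono :: "(nat \<Rightarrow> 'a \<Rightarrow> complex) \<Rightarrow> nat list \<Rightarrow> 'a \<Rightarrow> complex" where
  "lmono f [] x = 1"
| "lmono f (k # ks) x = f (length ks) x ^ k * lmono f ks x"

definition exps :: "nat \<Rightarrow> nat \<Rightarrow> nat list set" where
  "exps m s = {ks. set ks \<subseteq> {..s} \<and> length ks = m}"

lemma exps_finite: "finite (exps m s)"
  unfolding exps_def by (simp add: finite_lists_length_eq)

lemma exps_card: "card (exps m s) = (s + 1) ^ m"
  unfolding exps_def by (simp add: card_lists_length_eq)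

lemma exps_0: "exps 0 s = {[]}"
  unfolding exps_def by auto

lemma exps_Suc: "exps (Suc m) s = (\<lambda>(k, ks). k # ks) ` ({..s} \<times> exps m s)"
  unfolding exps_def by (auto simp: length_Suc_conv image_iff)

lemma sum_exps_Suc:
  "(\<Sum>ks\<in>exps (Suc m) s. F ks) = (\<Sum>k\<le>s. \<Sum>ks\<in>exps m s. F (k # ks))"
proof -
  have "inj_on (\<lambda>(k, ks). k # ks) ({..s} \<times> exps m s)" by (auto simp: inj_on_def)
  then show ?thesis
    unfolding exps_Suc by (simp add: sum.reindex sum.cartesian_product case_prod_unfold)
qed

text \<open>There are \<open>(s + 1) ^ m\<close> monomials in the \<open>f i\<close> with exponents at most \<open>s\<close>, and they lie in a
  space of dimension \<open>O(s ^ card V)\<close>.\<close>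
lemma algebraic_dependence:
  assumes "finite V" "\<And>i. i < m \<Longrightarrow> f i \<in> mpoly V" "card V < m"
  shows "\<exists>s a. (\<exists>ks\<in>exps m s. a ks \<noteq> 0) \<and> (\<forall>x. (\<Sum>ks\<in>exps m s. a ks * lmono f ks x) = 0)"
proof -
  have "\<forall>i\<in>{..<m}. \<exists>D. f i \<in> lspan (box_monomials V D)"
    using assms mpoly_in_lspan_box by blast
  then obtain E where E: "\<And>i. i < m \<Longrightarrow> f i \<in> lspan (box_monomials V (E i))"
    by (metis lessThan_iff)
  define D where "D = (\<Sum>i<m. E i)"
  have D: "f i \<in> lspan (box_monomials V D)" if "i < m" for i
  proof -
    have "E i \<le> D" unfolding D_def using that by (intro member_le_sum) auto
    then show ?thesis using E[OF that] box_monomials_mono lspan_mono by blast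
  qed
  have L: "lmono f ks \<in> lspan (box_monomials V (length ks * s * D))"
    if "length ks \<le> m" "set ks \<subseteq> {..s}" for ks s
    using that
  proof (induction ks)
    case (Cons k ks)
    have "k * D \<le> s * D" using Cons.prems by simp
    then have "(\<lambda>x. f (length ks) x ^ k) \<in> lspan (box_monomials V (s * D))"
      using lspan_box_power[OF D[of "length ks"], of k] Cons.prems box_monomials_mono lspan_mono
      by (metis Suc_le_eq length_Cons)
    from lspan_box_mult[OF this Cons.IH] Cons.prems show ?case
      by (simp add: algebra_simps fun_eq_iff)
  next
    case Nil
    have "lmono f [] = (\<lambda>x. 1)" by (rule ext) simp
    then show ?case using one_in_lspan_box[of V] by simp
  qed
  let ?d = "card V"
  \<comment> \<open>With d = card V, this s makes (m * s * D + 1) ^ d smaller than (s + 1) ^ (d +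
    1): the left side is at most (m * D + 1) ^ d * (s + 1) ^ d, whose first factor is s.\<close>
  define s where "s = (m * D + 1) ^ ?d"
  have "m * s * D + 1 \<le> (m * D + 1) * (s + 1)" by (simp add: algebra_simps)
  then have "(m * s * D + 1) ^ ?d \<le> ((m * D + 1) * (s + 1)) ^ ?d" by (rule power_mono) simp
  also have "\<dots> = s * (s + 1) ^ ?d" by (simp only: power_mult_distrib s_def)
  also have "\<dots> < (s + 1) ^ Suc ?d" by simp
  also have "\<dots> \<le> (s + 1) ^ m" using assms(3) by (intro power_increasing) auto
  finally have "card (box_monomials V (m * s * D)) < card (exps m s)"
    using box_monomials_card[OF assms(1), of "m * s * D"] by (simp add: exps_card)
  moreover have "lmono f ks \<in> lspan (box_monomials V (m * s * D))" if "ks \<in> exps m s" for ks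
    using L[of ks s] that by (auto simp: exps_def)
  ultimately have "\<exists>a. (\<exists>ks\<in>exps m s. a ks \<noteq> 0) \<and> (\<forall>x. (\<Sum>ks\<in>exps m s. a ks * lmono f ks x) = 0)"
    by (intro lspan_dependent[OF box_monomials_finite[OF assms(1)] exps_finite]) auto
  then show ?thesis by blast
qed

section \<open>Zariski closure and irreducible sets\<close>

lemma zar_closed_closure: "X \<subseteq> ambient n \<Longrightarrow> zar_closed n (zar_closure n X)"
  and zar_closure_eq: "X \<subseteq> ambient n \<Longrightarrow> zar_closure n X =
    {c \<in> ambient n. \<forall>f\<in>poly_fun n. (\<forall>x\<in>X. f x = 0) \<longrightarrow> f c = 0}"
proof -
  assume X: "X \<subseteq> ambient n"
  let ?I = "{f \<in> poly_fun n. \<forall>x\<in>X. f x = 0}"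
  let ?R = "{c \<in> ambient n. \<forall>f\<in>?I. f c = 0}"
  have R: "zar_closed n ?R" unfolding zar_closed_def by (intro exI[of _ ?I] conjI refl) simp
  have "X \<subseteq> ?R" using X by (simp add: subset_eq)
  with R have "zar_closure n X \<subseteq> ?R" unfolding zar_closure_def by (intro Inter_lower) simp
  moreover have "?R \<subseteq> zar_closure n X"
  proof
    fix c assume c: "c \<in> ?R"
    have "c \<in> Z" if Z: "zar_closed n Z" "X \<subseteq> Z" for Z
    proof -
      obtain F where F: "F \<subseteq> poly_fun n" "Z = {c \<in> ambient n. \<forall>f\<in>F. f c = 0}"
        using Z(1) unfolding zar_closed_def by blast
      have "f \<in> ?I" if "f \<in> F" for f
        using Z(2) F that by (simp add: subset_eq)
      with c show ?thesis unfolding F(2) by simp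
    qed
    then show "c \<in> zar_closure n X" unfolding zar_closure_def by simp
  qed
  ultimately have eq: "zar_closure n X = ?R" by (rule equalityI)
  with R show "zar_closed n (zar_closure n X)" by simp
  show "zar_closure n X = {c \<in> ambient n. \<forall>f\<in>poly_fun n. (\<forall>x\<in>X. f x = 0) \<longrightarrow> f c = 0}"
    unfolding eq by (simp add: Ball_def imp_conjL)
qed

lemma zar_closure_subset: "X \<subseteq> zar_closure n X"
  unfolding zar_closure_def by blast

lemma zar_closure_minimal: "zar_closed n Z \<Longrightarrow> X \<subseteq> Z \<Longrightarrow> zar_closure n X \<subseteq> Z"
  unfolding zar_closure_def by (intro Inter_lower) simp

lemma zar_closed_ambient: "zar_closed n Z \<Longrightarrow> Z \<subseteq> ambient n"
  unfolding zar_closed_def by blast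

lemma zar_closed_separate:
  assumes "zar_closed n Z" "c \<in> ambient n" "c \<notin> Z"
  shows "\<exists>f\<in>poly_fun n. (\<forall>z\<in>Z. f z = 0) \<and> f c \<noteq> 0"
proof -
  obtain F where F: "F \<subseteq> poly_fun n" "Z = {c \<in> ambient n. \<forall>f\<in>F. f c = 0}"
    using assms(1) unfolding zar_closed_def by blast
  with assms(2,3) obtain f where "f \<in> F" "f c \<noteq> 0" by auto
  moreover have "\<forall>z\<in>Z. f z = 0" using F(2) \<open>f \<in> F\<close> by simp
  ultimately show ?thesis using F(1) by blast
qed

lemma zar_closed_zeros: "f \<in> poly_fun n \<Longrightarrow> zar_closed n {c \<in> ambient n. f c = 0}"
  unfolding zar_closed_def by (rule exI[of _ "{f}"]) simp

lemma zar_irreducible_no_zero_divisors: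
  assumes "zar_irreducible n Z" "Z \<subseteq> ambient n" "f \<in> poly_fun n" "g \<in> poly_fun n"
    and "\<And>z. z \<in> Z \<Longrightarrow> f z * g z = 0"
  shows "(\<forall>z\<in>Z. f z = 0) \<or> (\<forall>z\<in>Z. g z = 0)"
proof -
  let ?Z1 = "{c \<in> ambient n. f c = 0}" and ?Z2 = "{c \<in> ambient n. g c = 0}"
  have "Z \<subseteq> ?Z1 \<union> ?Z2" using assms(2,5) by auto
  then have "Z \<subseteq> ?Z1 \<or> Z \<subseteq> ?Z2"
    using assms(1,3,4) zar_closed_zeros unfolding zar_irreducible_def by blast
  then show ?thesis by blast
qed

text \<open>If neither closed set contains the image, each misses a point of it. Polynomials
  separating these points pull back to nonzero functions on the parameter space, and a common point
  of nonvanishing is mapped outside both sets.\<close>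

lemma zar_irreducible_image:
  assumes "\<And>i j k. (\<lambda>x. \<phi> x i j k) \<in> mpoly V" "range \<phi> \<subseteq> ambient n"
  shows "zar_irreducible n (zar_closure n (range \<phi>))"
proof -
  interpret fun_alg "mpoly V" by (rule fun_alg_mpoly)
  have "zar_closure n (range \<phi>) \<subseteq> Z1 \<or> zar_closure n (range \<phi>) \<subseteq> Z2"
    if Z: "zar_closed n Z1" "zar_closed n Z2" "zar_closure n (range \<phi>) \<subseteq> Z1 \<union> Z2" for Z1 Z2
  proof (rule ccontr)
    assume "\<not> ?thesis"
    then obtain x y where xy: "\<phi> x \<notin> Z1" "\<phi> y \<notin> Z2"
      using zar_closure_minimal[of n Z1 "range \<phi>"] zar_closure_minimal[of n Z2 "range \<phi>"] Z by blast
    obtain f where f: "f \<in> poly_fun n" "\<And>z. z \<in> Z1 \<Longrightarrow> f z = 0" "f (\<phi> x) \<noteq> 0"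
      using zar_closed_separate[OF Z(1) _ xy(1)] assms(2) by blast
    obtain g where g: "g \<in> poly_fun n" "\<And>z. z \<in> Z2 \<Longrightarrow> g z = 0" "g (\<phi> y) \<noteq> 0"
      using zar_closed_separate[OF Z(2) _ xy(2)] assms(2) by blast
    obtain z where "f (\<phi> z) \<noteq> 0" "g (\<phi> z) \<noteq> 0"
      using mpoly_no_zero_divisors[OF poly_fun_comp[OF f(1), of \<phi>, OF assms(1)]
          poly_fun_comp[OF g(1), of \<phi>, OF assms(1)]] f(3) g(3) by blast
    with f(2) g(2) have "\<phi> z \<notin> Z1 \<union> Z2" by blast
    with Z(3) zar_closure_subset show False by blast
  qed
  moreover have "zar_closure n (range \<phi>) \<noteq> {}" using zar_closure_subset by blast
  ultimately show ?thesis unfolding zar_irreducible_def by blast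
qed

lemma lmono_poly_fun:
  "(\<And>i. i < length ks \<Longrightarrow> g i \<in> poly_fun n) \<Longrightarrow> lmono g ks \<in> poly_fun n"
proof -
  interpret fun_alg "poly_fun n" by (rule fun_alg_poly_fun)
  show "(\<And>i. i < length ks \<Longrightarrow> g i \<in> poly_fun n) \<Longrightarrow> lmono g ks \<in> poly_fun n"
  proof (induction ks)
    case (Cons k ks)
    then have "(\<lambda>x. g (length ks) x ^ k * lmono g ks x) \<in> poly_fun n"
      by (intro mult power Cons) auto
    then show ?case by (simp add: fun_eq_iff)
  next
    case Nil
    have "lmono g [] = (\<lambda>_. 1)" by (rule ext) simp
    then show ?case by (simp add: const)
  qed
qed

text \<open>In a relation among the monomials valid on \<open>Z (Suc m)\<close>, the lowest power of \<open>g m\<close> can be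
  cancelled by irreducibility; restricting to \<open>Z m\<close>, where \<open>g m\<close> vanishes, kills the other terms.\<close>
lemma irr_chain_independent:
  assumes "irr_chain n X m Z"
    and "\<And>i. i < m \<Longrightarrow> g i \<in> poly_fun n"
    and "\<And>i z. i < m \<Longrightarrow> z \<in> Z i \<Longrightarrow> g i z = 0"
    and "\<And>i. i < m \<Longrightarrow> \<exists>z\<in>Z (Suc i). g i z \<noteq> 0"
    and "\<And>z. z \<in> Z m \<Longrightarrow> (\<Sum>ks\<in>exps m s. a ks * lmono g ks z) = 0"
  shows "\<forall>ks\<in>exps m s. a ks = 0"
  using assms
proof (induction m arbitrary: a)
  case 0
  then obtain z where "z \<in> Z 0" unfolding irr_chain_def zar_irreducible_def by auto
  with 0(5) show ?case by (simp add: exps_0)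
next
  case (Suc m)
  interpret fun_alg "poly_fun n" by (rule fun_alg_poly_fun)
  define Q where "Q k z = (\<Sum>ks\<in>exps m s. a (k # ks) * lmono g ks z)" for k z
  have chain: "irr_chain n X m Z" using Suc.prems(1) unfolding irr_chain_def by auto
  have irr: "zar_irreducible n (Z (Suc m))" "Z (Suc m) \<subseteq> ambient n" and sub: "Z m \<subseteq> Z (Suc m)"
    using Suc.prems(1) zar_closed_ambient unfolding irr_chain_def by auto
  have Qp: "Q k \<in> poly_fun n" for k
    unfolding Q_def by (intro sum mult const lmono_poly_fun Suc.prems(2)) (auto simp: exps_def)
  have rel: "(\<Sum>k\<le>s. g m z ^ k * Q k z) = 0" if "z \<in> Z (Suc m)" for z
  proof -
    have "(\<Sum>k\<le>s. g m z ^ k * Q k z) = (\<Sum>k\<le>s. \<Sum>ks\<in>exps m s. a (k # ks) * lmono g (k # ks) z)"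
      unfolding Q_def sum_distrib_left
      by (intro sum.cong refl) (auto simp: exps_def algebra_simps)
    then show ?thesis using Suc.prems(5)[OF that] by (simp add: sum_exps_Suc)
  qed
  have zero: "\<forall>ks\<in>exps m s. a (k # ks) = 0" if "k \<le> s" for k
    using that
  proof (induction k rule: less_induct)
    case (less k)
    have Q0: "Q j z = 0" if "j < k" for j z
      using less.IH[of j] that less.prems unfolding Q_def by simp
    have split: "{..s} = {..<k} \<union> {k..s}" using less.prems by auto
    define R where "R z = (\<Sum>j\<in>{k..s}. g m z ^ (j - k) * Q j z)" for z
    have Rp: "R \<in> poly_fun n"
      unfolding R_def by (intro sum mult power Suc.prems(2) Qp) simp
    have "g m z ^ k * R z = 0" if "z \<in> Z (Suc m)" for z
    proof -
      have "(\<Sum>j\<le>s. g m z ^ j * Q j z) = (\<Sum>j\<in>{k..s}. g m z ^ j * Q j z)"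
        unfolding split using Q0 by (subst sum.union_disjoint) auto
      also have "\<dots> = g m z ^ k * R z"
        unfolding R_def sum_distrib_left
        by (intro sum.cong refl) (simp add: mult.assoc[symmetric] power_add[symmetric])
      finally show ?thesis using rel[OF that] by simp
    qed
    then have "(\<forall>z\<in>Z (Suc m). g m z ^ k = 0) \<or> (\<forall>z\<in>Z (Suc m). R z = 0)"
      using irr Rp Suc.prems(2)[of m]
      by (intro zar_irreducible_no_zero_divisors[of n "Z (Suc m)" "\<lambda>z. g m z ^ k" R] power) auto
    then have R0: "R z = 0" if "z \<in> Z (Suc m)" for z
      using Suc.prems(4)[of m] that by auto
    have "Q k z = 0" if z: "z \<in> Z m" for z
    proof -
      have "{k..s} = insert k {k<..s}" using less.prems by auto
      then have "R z = Q k z"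
        unfolding R_def using Suc.prems(3)[OF _ z] by (simp add: power_0_left)
      then show ?thesis using R0 z sub by auto
    qed
    then show ?case
      unfolding Q_def using chain Suc.prems(2-4) by (intro Suc.IH) auto
  qed
  show ?case using zero by (auto simp: exps_Suc)
qed

text \<open>Each step of the chain has a polynomial g i separating its two sets. More than card V of
  them become dependent after pulling back along \<phi>; the relation holds on the image, hence on
  its closure and on Z m, against \<open>irr_chain_independent\<close>.\<close>

theorem irr_chain_bound:
  assumes "\<And>i j k. (\<lambda>x. \<phi> x i j k) \<in> mpoly V" "finite V" "range \<phi> \<subseteq> ambient n"
    and "X \<subseteq> zar_closure n (range \<phi>)" "irr_chain n X m Z"
  shows "m \<le> card V"
proof (rule ccontr)
  assume "\<not> m \<le> card V"
  then have lt: "card V < m" by simp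
  interpret fun_alg "mpoly V" by (rule fun_alg_mpoly)
  have "\<exists>g. g \<in> poly_fun n \<and> (\<forall>z\<in>Z i. g z = 0) \<and> (\<exists>z\<in>Z (Suc i). g z \<noteq> 0)" if "i < m" for i
  proof -
    have "zar_closed n (Z i)" "zar_closed n (Z (Suc i))" "Z i \<subset> Z (Suc i)"
      using that assms(5) unfolding irr_chain_def by auto
    then show ?thesis
      using zar_closed_separate[of n "Z i"] zar_closed_ambient[of n "Z (Suc i)"] by blast
  qed
  then have "\<exists>g. \<forall>i. i < m \<longrightarrow>
      g i \<in> poly_fun n \<and> (\<forall>z\<in>Z i. g i z = 0) \<and> (\<exists>z\<in>Z (Suc i). g i z \<noteq> 0)"
    by (intro choice) blast
  then obtain g where g: "\<And>i. i < m \<Longrightarrow> g i \<in> poly_fun n" "\<And>i z. i < m \<Longrightarrow> z \<in> Z i \<Longrightarrow> g i z = 0"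
     "\<And>i. i < m \<Longrightarrow> \<exists>z\<in>Z (Suc i). g i z \<noteq> 0"
    by auto
  have g\<phi>: "(\<lambda>x. g i (\<phi> x)) \<in> mpoly V" if "i < m" for i
    by (rule poly_fun_comp[OF g(1)[OF that], of \<phi>, OF assms(1)])
  have "\<exists>s a. (\<exists>ks\<in>exps m s. a ks \<noteq> 0) \<and>
     (\<forall>x. (\<Sum>ks\<in>exps m s. a ks * lmono (\<lambda>i x. g i (\<phi> x)) ks x) = 0)"
    by (rule algebraic_dependence[OF assms(2) g\<phi> lt])
  then obtain s a where a: "\<exists>ks\<in>exps m s. a ks \<noteq> 0"
     "\<And>x. (\<Sum>ks\<in>exps m s. a ks * lmono (\<lambda>i x. g i (\<phi> x)) ks x) = 0"
    by blast
  have lm: "lmono (\<lambda>i x. g i (\<phi> x)) ks x = lmono g ks (\<phi> x)" for ks x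
    by (induction ks) auto
  interpret pf: fun_alg "poly_fun n" by (rule fun_alg_poly_fun)
  have "(\<lambda>c. \<Sum>ks\<in>exps m s. a ks * lmono g ks c) \<in> poly_fun n"
    by (intro pf.sum pf.mult pf.const lmono_poly_fun g(1)) (auto simp: exps_def)
  moreover have "Z m \<subseteq> zar_closure n (range \<phi>)"
    using assms(4,5) unfolding irr_chain_def by blast
  moreover have "\<forall>c\<in>range \<phi>. (\<Sum>ks\<in>exps m s. a ks * lmono g ks c) = 0"
    using a(2) unfolding lm by simp
  ultimately have "(\<Sum>ks\<in>exps m s. a ks * lmono g ks z) = 0" if "z \<in> Z m" for z
    using that unfolding zar_closure_eq[OF assms(3)] by auto
  from irr_chain_independent[OF assms(5) g this] a(1) show False by blast
qed

section \<open>Triangular structures and nilpotent algebras\<close>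

declare One_nat_def [simp del]

definition mv :: "nat \<Rightarrow> (nat \<Rightarrow> nat \<Rightarrow> complex) \<Rightarrow> (nat \<Rightarrow> complex) \<Rightarrow> nat \<Rightarrow> complex" where
  "mv n g x = (\<lambda>k. if k \<in> {1..n} then (\<Sum>l\<in>{1..n}. g k l * x l) else 0)"

definition mmul :: "nat \<Rightarrow> (nat \<Rightarrow> nat \<Rightarrow> complex) \<Rightarrow> (nat \<Rightarrow> nat \<Rightarrow> complex) \<Rightarrow> nat \<Rightarrow> nat \<Rightarrow> complex" where
  "mmul n a b = (\<lambda>i j. \<Sum>l\<in>{1..n}. a i l * b l j)"

definition unitv :: "nat \<Rightarrow> nat \<Rightarrow> complex" where
  "unitv i = (\<lambda>k. if k = i then 1 else 0)"

lemma vecsD: "x \<in> vecs n \<Longrightarrow> k \<notin> {1..n} \<Longrightarrow> x k = 0"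
  unfolding vecs_def by blast

lemma vecs_eqI: "x \<in> vecs n \<Longrightarrow> y \<in> vecs n \<Longrightarrow> (\<And>k. k \<in> {1..n} \<Longrightarrow> x k = y k) \<Longrightarrow> x = y"
  by (rule ext) (metis vecsD)

lemma mv_vecs: "mv n g x \<in> vecs n"
  unfolding mv_def vecs_def by auto

lemma amult_vecs: "amult n c x y \<in> vecs n"
  unfolding amult_def vecs_def by auto

lemma unitv_vecs: "i \<in> {1..n} \<Longrightarrow> unitv i \<in> vecs n"
  unfolding unitv_def vecs_def by auto

lemma sum_unitv: "finite A \<Longrightarrow> i \<in> A \<Longrightarrow> (\<Sum>l\<in>A. f l * unitv i l) = f i"
  unfolding unitv_def by (simp add: if_distrib cong: if_cong)

lemma mv_add: "mv n g (\<lambda>l. x l + y l) = (\<lambda>k. mv n g x k + mv n g y k)"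
  unfolding mv_def by (auto simp: fun_eq_iff algebra_simps sum.distrib)

lemma mv_smult: "mv n g (\<lambda>l. a * x l) = (\<lambda>k. a * mv n g x k)"
  unfolding mv_def by (auto simp: fun_eq_iff algebra_simps sum_distrib_left)

lemma mv_zero: "mv n g (\<lambda>_. 0) = (\<lambda>_. 0)"
  unfolding mv_def by auto

lemma amult_add_left: "amult n c (\<lambda>l. x l + y l) z = (\<lambda>k. amult n c x z k + amult n c y z k)"
  unfolding amult_def by (auto simp: fun_eq_iff algebra_simps sum.distrib)

lemma amult_smult_left: "amult n c (\<lambda>l. a * x l) z = (\<lambda>k. a * amult n c x z k)"
  unfolding amult_def by (auto simp: fun_eq_iff algebra_simps sum_distrib_left)

lemma amult_add_right: "amult n c z (\<lambda>l. x l + y l) = (\<lambda>k. amult n c z x k + amult n c z y k)"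
  unfolding amult_def by (auto simp: fun_eq_iff algebra_simps sum.distrib)

lemma amult_smult_right: "amult n c z (\<lambda>l. a * x l) = (\<lambda>k. a * amult n c z x k)"
  unfolding amult_def by (auto simp: fun_eq_iff algebra_simps sum_distrib_left)

lemma amult_zero: "amult n c (\<lambda>_. 0) x = (\<lambda>_. 0)" "amult n c x (\<lambda>_. 0) = (\<lambda>_. 0)"
  unfolding amult_def by auto

lemma amult_commute:
  assumes "commutative_alg c"
  shows "amult n c x y = amult n c y x"
proof -
  have "(\<Sum>i\<in>{1..n}. \<Sum>j\<in>{1..n}. x i * y j * c i j k) = (\<Sum>i\<in>{1..n}. \<Sum>j\<in>{1..n}. y i * x j * c i j k)" for k
  proof -
    have "c i j k = c j i k" for i j using assms unfolding commutative_alg_def by blast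
    then show ?thesis by (subst sum.swap) (intro sum.cong refl, simp add: mult.commute)
  qed
  then show ?thesis unfolding amult_def by (simp only:)
qed

lemma mv_unitv: "i \<in> {1..n} \<Longrightarrow> k \<in> {1..n} \<Longrightarrow> mv n g (unitv i) k = g k i"
  unfolding mv_def by (simp add: sum_unitv)

lemma amult_unitv:
  assumes "i \<in> {1..n}" "j \<in> {1..n}" "k \<in> {1..n}"
  shows "amult n c (unitv i) (unitv j) k = c i j k"
proof -
  have "amult n c (unitv i) (unitv j) k = (\<Sum>p\<in>{1..n}. (\<Sum>q\<in>{1..n}. c p q k * unitv j q) * unitv i p)"
    using assms unfolding amult_def by (simp add: sum_distrib_right sum_distrib_left algebra_simps)
  also have "\<dots> = c i j k" using assms by (simp only: sum_unitv finite_atLeastAtMost)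
  finally show ?thesis .
qed

text \<open>Together with \<open>amult_act\<close>, this reduces identities between transformed
  structures to compositions of linear maps.\<close>

lemma sc_eqI:
  assumes "c \<in> ambient n" "d \<in> ambient n"
    and "\<And>i j. i \<in> {1..n} \<Longrightarrow> j \<in> {1..n} \<Longrightarrow>
      amult n c (unitv i) (unitv j) = amult n d (unitv i) (unitv j)"
  shows "c = d"
proof (intro ext)
  fix i j k
  show "c i j k = d i j k"
  proof (cases "i \<in> {1..n} \<and> j \<in> {1..n} \<and> k \<in> {1..n}")
    case True
    then show ?thesis using assms(3)[of i j] amult_unitv[of i n j k] by metis
  next
    case False
    then have "c i j k = 0" "d i j k = 0" using assms(1,2) unfolding ambient_def by blast+
    then show ?thesis by simp
  qed
qed

lemma act_ambient: "act n g h c \<in> ambient n"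
  unfolding act_def ambient_def by auto

text \<open>When h is the inverse of g, this says that \<open>mv n g\<close> is a homomorphism from
  the transformed algebra to the original one.\<close>

lemma amult_act: "amult n (act n g h c) x y = mv n h (amult n c (mv n g x) (mv n g y))"
proof (rule ext)
  fix k
  let ?A = "{1..n}"
  show "amult n (act n g h c) x y k = mv n h (amult n c (mv n g x) (mv n g y)) k"
  proof (cases "k \<in> ?A")
    case True
    define T where "T i j p q r = x i * y j * (g p i * g q j * c p q r * h k r)" for i j p q r
    have "amult n (act n g h c) x y k = (\<Sum>i\<in>?A. \<Sum>j\<in>?A. \<Sum>p\<in>?A. \<Sum>q\<in>?A. \<Sum>r\<in>?A. T i j p q r)"
      using True unfolding amult_def act_def T_def
      by (simp add: sum_distrib_left del: atLeastAtMost_iff)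
    also have "\<dots> = (\<Sum>(i,j,p,q,r)\<in>?A\<times>?A\<times>?A\<times>?A\<times>?A. T i j p q r)"
      by (simp add: sum.cartesian_product)
    also have "\<dots> = (\<Sum>(r,p,q,i,j)\<in>?A\<times>?A\<times>?A\<times>?A\<times>?A. T i j p q r)"
      by (rule sum.reindex_bij_witness[of _ "\<lambda>(r,p,q,i,j). (i,j,p,q,r)" "\<lambda>(i,j,p,q,r). (r,p,q,i,j)"]) auto
    also have "\<dots> = (\<Sum>r\<in>?A. \<Sum>p\<in>?A. \<Sum>q\<in>?A. \<Sum>i\<in>?A. \<Sum>j\<in>?A. T i j p q r)"
      by (simp add: sum.cartesian_product)
    also have "\<dots> = (\<Sum>r\<in>?A. h k r * (\<Sum>p\<in>?A. \<Sum>q\<in>?A. (\<Sum>i\<in>?A. g p i * x i) * (\<Sum>j\<in>?A. g q j * y j) * c p q r))"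
      unfolding T_def sum_product unfolding sum_distrib_left sum_distrib_right
      by (intro sum.cong refl) (simp add: algebra_simps)
    also have "\<dots> = mv n h (amult n c (mv n g x) (mv n g y)) k"
      using True unfolding mv_def amult_def by (simp only: if_True) (intro sum.cong refl, simp)
    finally show ?thesis .
  next
    case False
    then show ?thesis unfolding mv_def amult_def by auto
  qed
qed

lemma mv_mmul: "mv n (mmul n a b) x = mv n a (mv n b x)"
proof (rule vecs_eqI[OF mv_vecs mv_vecs])
  fix k assume k: "k \<in> {1..n}"
  have "(\<Sum>l\<in>{1..n}. (\<Sum>m\<in>{1..n}. a k m * b m l) * x l) = (\<Sum>l\<in>{1..n}. a k l * (\<Sum>m\<in>{1..n}. b l m * x m))"
    unfolding sum_distrib_left sum_distrib_right
    by (subst sum.swap) (simp add: mult.assoc)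
  then show "mv n (mmul n a b) x k = mv n a (mv n b x) k"
    using k unfolding mv_def mmul_def by (simp del: atLeastAtMost_iff)
qed

lemma act_act: "act n b b' (act n a a' c) = act n (mmul n a b) (mmul n b' a') c"
  by (rule sc_eqI[of _ n]) (simp_all add: act_ambient amult_act mv_mmul)

lemma mv_cong: "(\<And>i j. i \<in> {1..n} \<Longrightarrow> j \<in> {1..n} \<Longrightarrow> g i j = g' i j) \<Longrightarrow> mv n g = mv n g'"
  unfolding mv_def by (auto intro!: ext sum.cong)

lemma mv_delta:
  assumes "\<And>i j. i \<in> {1..n} \<Longrightarrow> j \<in> {1..n} \<Longrightarrow> g i j = (if i = j then a else 0)" "x \<in> vecs n"
  shows "mv n g x = (\<lambda>k. a * x k)"
proof (rule vecs_eqI[OF mv_vecs])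
  show "(\<lambda>k. a * x k) \<in> vecs n" using assms(2) unfolding vecs_def by simp
  fix k assume k: "k \<in> {1..n}"
  have "mv n g x k = (\<Sum>l\<in>{1..n}. if k = l then a * x l else 0)"
    using k unfolding mv_def by (simp only: if_True) (intro sum.cong, auto simp: assms(1))
  then show "mv n g x k = a * x k" using k by simp
qed

lemma inv_pair_commute: "inv_pair n g h \<Longrightarrow> inv_pair n h g"
  unfolding inv_pair_def by blast

lemma inv_pair_mv:
  assumes "inv_pair n g h" "x \<in> vecs n"
  shows "mv n g (mv n h x) = x"
  using mv_delta[of n "mmul n g h" 1 x] assms unfolding inv_pair_def mv_mmul[symmetric] mmul_def
  by simp

lemma inv_pairI_fdet:
  assumes "fdet n g \<noteq> 0"
  shows "inv_pair n g (\<lambda>i j. fadj n g i j / fdet n g)"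
proof -
  have "(\<Sum>l\<in>{1..n}. g i l * (fadj n g l j / fdet n g)) = (if i = j then 1 else 0)"
    "(\<Sum>l\<in>{1..n}. fadj n g i l / fdet n g * g l j) = (if i = j then 1 else 0)"
    if "i \<in> {1..n}" "j \<in> {1..n}" for i j
    using fadj_mult[OF that, of g] assms
    by (simp_all add: sum_divide_distrib[symmetric])
  then show ?thesis unfolding inv_pair_def by blast
qed

lemma act_inverse:
  assumes "inv_pair n g h" "c \<in> ambient n"
  shows "act n h g (act n g h c) = c"
  using assms(2)
  by (intro sc_eqI[of _ n])
    (simp_all add: act_ambient amult_act inv_pair_mv[OF assms(1)] unitv_vecs amult_vecs
      del: atLeastAtMost_iff)

lemma act_commutative: "commutative_alg c \<Longrightarrow> commutative_alg (act n g h c)"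
  unfolding commutative_alg_def
proof (intro allI)
  fix i j k assume c: "\<forall>i j k. c i j k = c j i k"
  show "act n g h c i j k = act n g h c j i k"
  proof (cases "i \<in> {1..n} \<and> j \<in> {1..n} \<and> k \<in> {1..n}")
    case True
    have "amult n c x y = amult n c y x" for x y using c amult_commute unfolding commutative_alg_def by blast
    then show ?thesis using True amult_act[of n g h c] amult_unitv[of _ n _ k "act n g h c"] by metis
  next
    case False
    then show ?thesis unfolding act_def by auto
  qed
qed

lemma apow_vecs: "apow n c k x \<Longrightarrow> x \<in> vecs n"
  by (induction rule: apow.induct) (auto simp: amult_vecs, auto simp: vecs_def)

lemma apow_act:
  assumes "inv_pair n g h"
  shows "apow n (act n g h c) k x \<Longrightarrow> apow n c k (mv n g x)"
proof (induction rule: apow.induct)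
  case (ap_base x)
  then show ?case by (intro apow.ap_base mv_vecs)
next
  case (ap_prod i j x y)
  then show ?case by (simp add: amult_act inv_pair_mv[OF assms] amult_vecs apow.ap_prod)
qed (simp_all add: mv_zero mv_add mv_smult apow.intros)

definition tri :: "nat \<Rightarrow> sc set" where
  "tri n = {c \<in> ambient n. commutative_alg c \<and> (\<forall>i j k. k \<le> max i j \<longrightarrow> c i j k = 0)}"

text \<open>The spans of e_j, ..., e_n form a flag of ideals, and every product with an element of
  one of them lies in the next.\<close>

lemma tri_amult_zero:
  assumes "c \<in> tri n" "\<And>l. l < j \<Longrightarrow> y l = 0" "k \<le> j"
  shows "amult n c x y k = 0" "amult n c y x k = 0"
proof -
  have "x p * y q * c p q k = 0" for p q
  proof (cases "q < j")
    case False
    then have "c p q k = 0" using assms(1,3) unfolding tri_def by (auto simp: max_def)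
    then show ?thesis by simp
  qed (simp add: assms(2))
  then show "amult n c x y k = 0" unfolding amult_def by (simp only: sum.neutral_const if_cancel)
  then show "amult n c y x k = 0"
    using amult_commute[of c n x y] assms(1) unfolding tri_def by simp
qed

text \<open>The nilpotency index of a strictly triangular algebra grows exponentially with \<open>n\<close>: a product
  in \<open>N^k\<close> is only known to have one factor in \<open>N^i\<close> with \<open>2 * i \<ge> k\<close>.\<close>
lemma tri_apow: "c \<in> tri n \<Longrightarrow> apow n c k x \<Longrightarrow> x l \<noteq> 0 \<Longrightarrow> k \<le> 2 ^ l"
proof -
  assume c: "c \<in> tri n"
  show "apow n c k x \<Longrightarrow> x l \<noteq> 0 \<Longrightarrow> k \<le> 2 ^ l"
  proof (induction arbitrary: l rule: apow.induct)
    case (ap_prod i j x y)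
    obtain p q where pq: "x p * y q * c p q l \<noteq> 0"
    proof -
      have "\<exists>p\<in>{1..n}. \<exists>q\<in>{1..n}. x p * y q * c p q l \<noteq> 0"
      proof (rule ccontr)
        assume "\<not> ?thesis"
        then have "amult n c x y l = 0" unfolding amult_def by (auto intro!: sum.neutral)
        then show False using ap_prod.prems by simp
      qed
      then show thesis using that by blast
    qed
    have "\<not> l \<le> max p q"
    proof
      assume "l \<le> max p q"
      then have "c p q l = 0" using c unfolding tri_def by blast
      with pq show False by simp
    qed
    then have "max p q < l" by (simp only: not_le)
    have "i \<le> 2 ^ p" "j \<le> 2 ^ q" using pq ap_prod.IH by auto
    moreover have "(2::nat) ^ p \<le> 2 ^ (l - 1)" "(2::nat) ^ q \<le> 2 ^ (l - 1)"
      using \<open>max p q < l\<close> by (intro power_increasing; linarith)+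
    moreover have "(2::nat) ^ l = 2 * 2 ^ (l - 1)" using \<open>max p q < l\<close> by (cases l) auto
    ultimately show ?case by linarith
  next
    case (ap_add k x y)
    then have "x l \<noteq> 0 \<or> y l \<noteq> 0" by auto
    with ap_add.IH show ?case by blast
  qed auto
qed

lemma act_tri_apow:
  assumes "inv_pair n g h" "t \<in> tri n" "apow n (act n g h t) (2 ^ n + 1) x"
  shows "x = (\<lambda>_. 0)"
proof -
  have x: "apow n t (2 ^ n + 1) (mv n g x)" by (rule apow_act[OF assms(1,3)])
  have "mv n g x l = 0" for l
  proof (rule ccontr)
    assume *: "mv n g x l \<noteq> 0"
    then have "l \<le> n" using vecsD[OF mv_vecs, of l n g x] by (cases "l \<in> {1..n}") auto
    then have "(2::nat) ^ l \<le> 2 ^ n" by (rule power_increasing) simp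
    with tri_apow[OF assms(2) x *] show False by simp
  qed
  then have "mv n h (mv n g x) = (\<lambda>_. 0)" using mv_zero by presburger
  then show ?thesis using inv_pair_mv[OF inv_pair_commute[OF assms(1)] apow_vecs[OF assms(3)]] by simp
qed

lemma act_tri_CNil:
  assumes "inv_pair n g h" "t \<in> tri n"
  shows "act n g h t \<in> CNil n"
proof -
  have "nilpotent_alg n (act n g h t)"
    unfolding nilpotent_alg_def using act_tri_apow[OF assms] by (intro exI[of _ "2 ^ n + 1"]) simp
  then show ?thesis
    using assms(2) act_ambient act_commutative unfolding CNil_def tri_def by blast
qed

lemma lspan_units:
  assumes "x \<in> vecs n"
  shows "x \<in> lspan (unitv ` {1..n})"
proof -
  have "(\<lambda>k. \<Sum>i\<in>{1..n}. x i * unitv i k) \<in> lspan (unitv ` {1..n})"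
    by (intro lspan_sum lspan_smult lspan_superset imageI)
  moreover have "(\<Sum>i\<in>{1..n}. x i * unitv i k) = x k" for k
    using vecsD[OF assms, of k] unfolding unitv_def by (simp add: if_distrib cong: if_cong)
  ultimately show ?thesis by simp
qed

lemma amult_lspan:
  assumes "x \<in> lspan A" "y \<in> lspan B"
    and "\<And>a b. a \<in> A \<Longrightarrow> b \<in> B \<Longrightarrow> amult n c a b \<in> lspan D"
  shows "amult n c x y \<in> lspan D"
  using assms(1)
proof induction
  case lspan_zero
  then show ?case by (simp add: amult_zero lspan.lspan_zero)
next
  case (lspan_step x a r)
  have "amult n c a y \<in> lspan D"
    using assms(2)
  proof induction
    case lspan_zero
    then show ?case by (simp add: amult_zero lspan.lspan_zero)
  next
    case (lspan_step y b r)
    then show ?case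
      using assms(3)[OF \<open>a \<in> A\<close> lspan_step(2)]
      by (simp add: amult_add_right amult_smult_right lspan_add lspan_smult)
  qed
  with lspan_step show ?case
    by (simp add: amult_add_left amult_smult_left lspan_add lspan_smult)
qed

text \<open>Take the last power N^k that is not contained in the span of B. It exists because N
  itself has dimension n > card B and some power is zero. Any b in N^k outside the span works, since
  y * b lies in N^(k+1).\<close>

lemma next_basis_vector:
  assumes "nilpotent_alg n c" "finite B" "card B < n"
  shows "\<exists>b\<in>vecs n. b \<notin> lspan B \<and> (\<forall>y\<in>vecs n. amult n c y b \<in> lspan B)"
proof -
  define P where "P k \<longleftrightarrow> (\<forall>x. apow n c k x \<longrightarrow> x \<in> lspan B)" for k
  have "\<not> P 1"
  proof
    assume "P 1"
    then have "unitv a \<in> lspan B" if "a \<in> {1..n}" for a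
      unfolding P_def using unitv_vecs[OF that] apow.ap_base by blast
    then obtain v a where v: "a \<in> {1..n}" "v a \<noteq> 0" "(\<Sum>i\<in>{1..n}. v i * unitv i a) = 0"
      using lspan_dependent[OF assms(2), of "{1..n}" unitv] assms(3) by auto
    moreover have "(\<Sum>i\<in>{1..n}. v i * unitv i a) = v a"
      using v(1) unfolding unitv_def by (simp add: if_distrib cong: if_cong)
    ultimately show False by simp
  qed
  moreover obtain K where "1 \<le> K" "P K"
    using assms(1) lspan_zero unfolding nilpotent_alg_def P_def by metis
  ultimately obtain k where k: "1 \<le> k" "\<not> P k" "P (Suc k)"
    using dec_induct[of 1 K "\<lambda>k. \<not> P k"] by blast
  then obtain b where b: "apow n c k b" "b \<notin> lspan B" unfolding P_def by blast
  have "amult n c y b \<in> lspan B" if "y \<in> vecs n" for y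
    using apow.ap_prod[OF _ k(1) apow.ap_base[OF that] b(1)] k(3) unfolding P_def by (simp add: One_nat_def)
  with b apow_vecs show ?thesis by blast
qed

lemma adapted_basis:
  assumes "nilpotent_alg n c"
  shows "\<exists>b. \<forall>i\<in>{1..n}. b i \<in> vecs n \<and> b i \<notin> lspan (b ` {i<..n}) \<and>
    (\<forall>y\<in>vecs n. amult n c y (b i) \<in> lspan (b ` {i<..n}))"
proof -
  \<comment> \<open>The basis is built from the last index downwards; m counts the vectors already
    chosen.\<close>
  have *: "\<exists>b. \<forall>i\<in>{n - m<..n}. b i \<in> vecs n \<and> b i \<notin> lspan (b ` {i<..n}) \<and>
    (\<forall>y\<in>vecs n. amult n c y (b i) \<in> lspan (b ` {i<..n}))" if "m \<le> n" for m
    using that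
  proof (induction m)
    case 0
    then show ?case by simp
  next
    case (Suc m)
    then obtain b where b: "\<forall>i\<in>{n - m<..n}. b i \<in> vecs n \<and> b i \<notin> lspan (b ` {i<..n}) \<and>
      (\<forall>y\<in>vecs n. amult n c y (b i) \<in> lspan (b ` {i<..n}))" by auto
    have "card (b ` {n - m<..n}) \<le> card {n - m<..n}" by (rule card_image_le) simp
    then have "card (b ` {n - m<..n}) < n" using Suc.prems by simp
    then obtain v where v: "v \<in> vecs n" "v \<notin> lspan (b ` {n - m<..n})"
        "\<forall>y\<in>vecs n. amult n c y v \<in> lspan (b ` {n - m<..n})"
      using next_basis_vector[OF assms, of "b ` {n - m<..n}"] by auto
    let ?b = "b(n - m := v)"
    have img: "?b ` {i<..n} = b ` {i<..n}" if "n - m \<le> i" for i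
      using that by (intro image_cong) auto
    show ?case
    proof (intro exI[of _ ?b] ballI)
      fix i assume i: "i \<in> {n - Suc m<..n}"
      show "?b i \<in> vecs n \<and> ?b i \<notin> lspan (?b ` {i<..n}) \<and>
        (\<forall>y\<in>vecs n. amult n c y (?b i) \<in> lspan (?b ` {i<..n}))"
      proof (cases "i = n - m")
        case True
        then show ?thesis using v img[of i] by (simp del: fun_upd_apply) simp
      next
        case False
        then have "i \<in> {n - m<..n}" using i by auto
        then show ?thesis using b img[of i] False by (simp del: fun_upd_apply) simp
      qed
    qed
  qed
  have "{n - n<..n} = {1..n}" by auto
  with *[OF order_refl] show ?thesis by (simp only:)
qed

lemma CNil_act_tri:
  assumes "c \<in> CNil n"
  shows "\<exists>g h t. inv_pair n g h \<and> t \<in> tri n \<and> c = act n g h t"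
proof -
  have c: "c \<in> ambient n" "commutative_alg c" "nilpotent_alg n c"
    using assms unfolding CNil_def by auto
  obtain b where b: "\<And>i. i \<in> {1..n} \<Longrightarrow> b i \<in> vecs n"
     "\<And>i. i \<in> {1..n} \<Longrightarrow> b i \<notin> lspan (b ` {i<..n})"
     "\<And>i y. i \<in> {1..n} \<Longrightarrow> y \<in> vecs n \<Longrightarrow> amult n c y (b i) \<in> lspan (b ` {i<..n})"
    using adapted_basis[OF c(3)] by blast
  define g where "g p i = b i p" for p i
  have "fdet n g \<noteq> 0"
  proof
    assume "fdet n g = 0"
    then obtain v where v: "v \<in> vecs n" "v \<noteq> (\<lambda>_. 0)" "\<And>p. p \<in> {1..n} \<Longrightarrow> (\<Sum>i\<in>{1..n}. b i p * v i) = 0"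
      unfolding fdet_eq_0_iff g_def by blast
    have v3: "(\<Sum>i\<in>{1..n}. b i p * v i) = 0" for p
    proof (cases "p \<in> {1..n}")
      case False
      show ?thesis by (rule sum.neutral) (use vecsD[OF b(1) False] in simp)
    qed (rule v(3))
    \<comment> \<open>The first nonzero coefficient of a relation would express b m through later
      vectors, contrary to its choice.\<close>
    define m where "m = (LEAST i. v i \<noteq> 0)"
    have m: "v m \<noteq> 0" unfolding m_def by (rule LeastI_ex) (use v(2) in blast)
    have m': "v i = 0" if "i < m" for i
      using not_less_Least[of i "\<lambda>i. v i \<noteq> 0"] that unfolding m_def by blast
    have mn: "m \<in> {1..n}" using vecsD[OF v(1), of m] m by blast
    have "b m p = (\<Sum>i\<in>{m<..n}. (- v i / v m) * b i p)" for p
    proof -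
      have "{1..n} = {1..<m} \<union> insert m {m<..n}" using mn by auto
      then have "(\<Sum>i\<in>{1..n}. b i p * v i) = (\<Sum>i\<in>{1..<m}. b i p * v i) + (\<Sum>i\<in>insert m {m<..n}. b i p * v i)"
        by (simp only:) (rule sum.union_disjoint; auto)
      also have "\<dots> = b m p * v m + (\<Sum>i\<in>{m<..n}. b i p * v i)" using m' by simp
      finally have "b m p * v m = - (\<Sum>i\<in>{m<..n}. b i p * v i)" using v3[of p] by (simp add: add_eq_0_iff2)
      then have "b m p = - (\<Sum>i\<in>{m<..n}. b i p * v i) / v m" using m by (simp add: field_simps)
      then show ?thesis by (simp add: sum_negf[symmetric] sum_divide_distrib mult.commute)
    qed
    then have "b m = (\<lambda>p. \<Sum>i\<in>{m<..n}. (- v i / v m) * b i p)" by (rule ext)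
    moreover have "(\<lambda>p. \<Sum>i\<in>{m<..n}. (- v i / v m) * b i p) \<in> lspan (b ` {m<..n})"
      by (intro lspan_sum lspan_smult lspan_superset imageI)
    ultimately show False using b(2)[OF mn] by simp
  qed
  then obtain h where gh: "inv_pair n g h" using inv_pairI_fdet by blast
  have gu: "mv n g (unitv i) = b i" if "i \<in> {1..n}" for i
    by (rule vecs_eqI[OF mv_vecs b(1)[OF that]]) (simp add: mv_unitv[OF that] g_def)
  \<comment> \<open>In the new coordinates, the span of the vectors after b j has only entries
    beyond j; so the flag condition on b becomes strict triangularity.\<close>
  have hz: "mv n h x k = 0" if "x \<in> lspan (b ` {j<..n})" "k \<le> j" for x k j
    using that(1)
  proof induction
    case lspan_zero
    then show ?case by (simp add: mv_zero)
  next
    case (lspan_step x b' a)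
    then obtain l where l: "b' = b l" "l \<in> {j<..n}" by blast
    then have "mv n h b' = unitv l"
      using inv_pair_mv[OF inv_pair_commute[OF gh] unitv_vecs, of l] gu[of l] by auto
    then show ?case using lspan_step.IH l(2) that(2) by (simp add: mv_add mv_smult unitv_def)
  qed
  define t where "t = act n g h c"
  have tc: "commutative_alg t" unfolding t_def by (rule act_commutative[OF c(2)])
  have t0: "t i j k = 0" if "k \<le> j" for i j k
  proof (cases "i \<in> {1..n} \<and> j \<in> {1..n} \<and> k \<in> {1..n}")
    case True
    then have "t i j k = amult n t (unitv i) (unitv j) k" by (simp only: amult_unitv)
    also have "\<dots> = mv n h (amult n c (b i) (b j)) k"
      using True unfolding t_def amult_act by (simp only: gu)
    also have "\<dots> = 0" by (rule hz[OF b(3) that]) (use b(1) True in auto)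
    finally show ?thesis .
  next
    case False
    then show ?thesis unfolding t_def act_def by auto
  qed
  have "t i j k = 0" if "k \<le> max i j" for i j k
  proof (cases "k \<le> j")
    case False
    then have "t j i k = 0" using that by (intro t0) simp
    then show ?thesis using tc unfolding commutative_alg_def by simp
  qed (rule t0)
  then have "t \<in> tri n" using tc act_ambient unfolding tri_def t_def by blast
  moreover have "c = act n h g t" unfolding t_def using act_inverse[OF gh c(1)] by simp
  ultimately show ?thesis using inv_pair_commute[OF gh] by blast
qed

text \<open>Bracketed products of k basis vectors, kept as functions of the structure constants:
  \<open>apow\<close> belongs to one algebra, whereas closedness needs equations of the same form
  for all c.\<close>

inductive basis_product :: "nat \<Rightarrow> nat \<Rightarrow> (sc \<Rightarrow> nat \<Rightarrow> complex) \<Rightarrow> bool" for n where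
  bp_unit: "i \<in> {1..n} \<Longrightarrow> basis_product n 1 (\<lambda>c. unitv i)"
| bp_prod: "1 \<le> i \<Longrightarrow> 1 \<le> j \<Longrightarrow> basis_product n i P \<Longrightarrow> basis_product n j Q \<Longrightarrow>
    basis_product n (i + j) (\<lambda>c. amult n c (P c) (Q c))"

lemma basis_product_poly_fun: "basis_product n k P \<Longrightarrow> (\<lambda>c. P c l) \<in> poly_fun n"
proof (induction arbitrary: l rule: basis_product.induct)
  case (bp_unit i)
  show ?case by (rule pf_const)
next
  case (bp_prod i j P Q)
  interpret fun_alg "poly_fun n" by (rule fun_alg_poly_fun)
  show ?case
  proof (cases "l \<in> {1..n}")
    case True
    then show ?thesis
      unfolding amult_def by (simp only: if_True) (intro sum mult bp_prod.IH pf_coord True)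
  next
    case False
    then show ?thesis unfolding amult_def by (simp only: if_False const)
  qed
qed

lemma basis_product_apow: "basis_product n k P \<Longrightarrow> apow n c k (P c)"
  by (induction rule: basis_product.induct) (simp_all add: apow.intros unitv_vecs)

definition product_span :: "nat \<Rightarrow> sc \<Rightarrow> nat \<Rightarrow> (nat \<Rightarrow> complex) set" where
  "product_span n c k = lspan ((\<lambda>P. P c) ` Collect (basis_product n k))"

lemma basis_product_span: "basis_product n k P \<Longrightarrow> P c \<in> product_span n c k"
  unfolding product_span_def by (rule lspan_superset, rule imageI, rule CollectI)

lemma apow_product_span: "apow n c k x \<Longrightarrow> x \<in> product_span n c k"
proof (induction rule: apow.induct)
  case (ap_base x)
  have "unitv i \<in> (\<lambda>P. P c) ` Collect (basis_product n 1)" if "i \<in> {1..n}" for i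
    by (rule image_eqI[of _ _ "\<lambda>c. unitv i"]) (simp_all only: mem_Collect_eq bp_unit that)
  then have "unitv ` {1..n} \<subseteq> (\<lambda>P. P c) ` Collect (basis_product n 1)"
    by (rule image_subsetI)
  then show ?case unfolding product_span_def by (rule lspan_mono[OF lspan_units[OF ap_base]])
next
  case (ap_prod i j x y)
  show ?case
    unfolding product_span_def
  proof (rule amult_lspan[OF ap_prod.IH[unfolded product_span_def]])
    fix a b assume "a \<in> (\<lambda>P. P c) ` Collect (basis_product n i)" "b \<in> (\<lambda>P. P c) ` Collect (basis_product n j)"
    then obtain P Q where PQ: "basis_product n i P" "basis_product n j Q" and ab: "a = P c" "b = Q c"
      by (elim imageE CollectE)
    show "amult n c a b \<in> lspan ((\<lambda>P. P c) ` Collect (basis_product n (i + j)))"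
      using basis_product_span[OF bp_prod[OF ap_prod.hyps(1,2) PQ], of c]
      unfolding ab product_span_def .
  qed
next
  case (ap_add k x y)
  then show ?case unfolding product_span_def by (intro lspan_add)
next
  case (ap_smult k x a)
  then show ?case unfolding product_span_def by (intro lspan_smult)
qed (simp add: product_span_def lspan_zero)

text \<open>By transport to \<open>tri n\<close>, the exponent 2 ^ n + 1 serves all nilpotent
  algebras at once. This turns the existential quantifier over exponents, a union of closed
  conditions, into a single system of equations.\<close>

lemma CNil_eq:
  "CNil n = {c \<in> ambient n. commutative_alg c \<and>
    (\<forall>P\<in>Collect (basis_product n (2 ^ n + 1)). P c = (\<lambda>_. 0))}" (is "_ = ?R")
proof (intro equalityI subsetI)
  fix c assume c: "c \<in> CNil n"
  then obtain g h t where ght: "inv_pair n g h" "t \<in> tri n" "c = act n g h t"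
    using CNil_act_tri by blast
  have "P c = (\<lambda>_. 0)" if "P \<in> Collect (basis_product n (2 ^ n + 1))" for P
    using act_tri_apow[OF ght(1,2)] basis_product_apow[OF CollectD[OF that], of c]
    unfolding ght(3) .
  moreover have "c \<in> ambient n" "commutative_alg c" using c unfolding CNil_def by simp_all
  ultimately show "c \<in> ?R" by (intro CollectI conjI ballI)
next
  fix c assume c: "c \<in> ?R"
  have P: "P c = (\<lambda>_. 0)" if "P \<in> Collect (basis_product n (2 ^ n + 1))" for P
    by (rule bspec[OF _ that]) (use c in simp)
  have "x = (\<lambda>_. 0)" if "apow n c (2 ^ n + 1) x" for x
    using apow_product_span[OF that] unfolding product_span_def
  proof induction
    case (lspan_step f b a)
    then obtain P where "P \<in> Collect (basis_product n (2 ^ n + 1))" "b = P c" by (elim imageE)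
    then have "b = (\<lambda>_. 0)" by (simp only: P)
    with lspan_step.IH show ?case by simp
  qed simp
  then have "nilpotent_alg n c" unfolding nilpotent_alg_def by (intro exI[of _ "2 ^ n + 1"]) simp
  then show "c \<in> CNil n" using c unfolding CNil_def by simp
qed

lemma CNil_closed: "zar_closed n (CNil n)"
proof -
  interpret fun_alg "poly_fun n" by (rule fun_alg_poly_fun)
  define F1 where "F1 = (\<lambda>(i, j, k) c. c i j k - c j i k :: complex) ` ({1..n} \<times> {1..n} \<times> {1..n})"
  define F2 where "F2 = {f. \<exists>P l. basis_product n (2 ^ n + 1) P \<and> f = (\<lambda>c. P c l)}"
  have coord: "(\<lambda>c. c i j k - c j i k) \<in> poly_fun n" if "i \<in> {1..n}" "j \<in> {1..n}" "k \<in> {1..n}" for i j k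
    by (rule diff[OF pf_coord[OF that] pf_coord[OF that(2,1,3)]])
  have "F1 \<subseteq> poly_fun n"
    unfolding F1_def using coord by (simp add: image_subset_iff)
  moreover have "F2 \<subseteq> poly_fun n"
  proof
    fix f assume "f \<in> F2"
    then obtain P l where P: "basis_product n (2 ^ n + 1) P" and f: "f = (\<lambda>c. P c l)"
      unfolding F2_def by (elim CollectE exE conjE)
    show "f \<in> poly_fun n" unfolding f by (rule basis_product_poly_fun[OF P])
  qed
  ultimately have "F1 \<union> F2 \<subseteq> poly_fun n" by (rule Un_least)
  moreover have "CNil n = {c \<in> ambient n. \<forall>f\<in>F1 \<union> F2. f c = 0}"
  proof -
    have F1: "commutative_alg c \<longleftrightarrow> (\<forall>f\<in>F1. f c = 0)" if c: "c \<in> ambient n" for c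
    proof
      assume "commutative_alg c"
      then show "\<forall>f\<in>F1. f c = 0" unfolding F1_def commutative_alg_def by (simp add: case_prod_beta)
    next
      assume F: "\<forall>f\<in>F1. f c = 0"
      show "commutative_alg c"
        unfolding commutative_alg_def
      proof (intro allI)
        fix i j k
        show "c i j k = c j i k"
        proof (cases "(i, j, k) \<in> {1..n} \<times> {1..n} \<times> {1..n}")
          case True
          then show ?thesis using bspec[OF F[unfolded F1_def], OF imageI[OF True]] by simp
        next
          case False
          then have "c i j k = 0" "c j i k = 0" using c unfolding ambient_def by simp_all
          then show ?thesis by simp
        qed
      qed
    qed
    have F2: "(\<forall>P\<in>Collect (basis_product n (2 ^ n + 1)). P c = (\<lambda>_. 0)) \<longleftrightarrow> (\<forall>f\<in>F2. f c = 0)" for c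
    proof
      assume P: "\<forall>P\<in>Collect (basis_product n (2 ^ n + 1)). P c = (\<lambda>_. 0)"
      show "\<forall>f\<in>F2. f c = 0"
        unfolding F2_def
      proof (rule ballI, elim CollectE exE conjE)
        fix f Q l assume "f = (\<lambda>c. Q c l)" "basis_product n (2 ^ n + 1) Q"
        with bspec[OF P, of Q] show "f c = 0" by simp
      qed
    next
      assume F: "\<forall>f\<in>F2. f c = 0"
      show "\<forall>P\<in>Collect (basis_product n (2 ^ n + 1)). P c = (\<lambda>_. 0)"
      proof (intro ballI ext)
        fix P l assume "P \<in> Collect (basis_product n (2 ^ n + 1))"
        then have "(\<lambda>c. P c l) \<in> F2"
          unfolding F2_def mem_Collect_eq by (intro exI[of _ P] exI[of _ l]) simp
        from bspec[OF F this] show "P c l = 0" .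
      qed
    qed
    have U: "(\<forall>f\<in>F1 \<union> F2. f c = 0) \<longleftrightarrow> (\<forall>f\<in>F1. f c = 0) \<and> (\<forall>f\<in>F2. f c = 0)" for c
      by (rule ball_Un)
    have "c \<in> ambient n \<and> commutative_alg c \<and> (\<forall>f\<in>F2. f c = 0) \<longleftrightarrow>
        c \<in> ambient n \<and> (\<forall>f\<in>F1 \<union> F2. f c = 0)" for c
      using F1[of c] unfolding U by argo
    then show ?thesis unfolding CNil_eq F2 by (rule Collect_cong)
  qed
  ultimately show ?thesis unfolding zar_closed_def by (intro exI[of _ "F1 \<union> F2"] conjI)
qed

section \<open>A parametrisation of the commutative nilpotent algebras\<close>

text \<open>For \<open>1 \<le> i\<close>, the parameter \<open>(k, j, i)\<close> is the structure constant \<open>c i j k\<close>; the parameter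
  \<open>(m, p, 0)\<close> is the entry in row \<open>p\<close> and column \<open>m\<close> of the unipotent matrix.\<close>
definition params :: "nat \<Rightarrow> (nat \<times> nat \<times> nat) set" where
  "params n = (SIGMA k:{1..n}. SIGMA j:{1..<k}. {0..j})"

definition upper :: "nat \<Rightarrow> (nat \<times> nat \<times> nat \<Rightarrow> complex) \<Rightarrow> nat \<Rightarrow> nat \<Rightarrow> complex" where
  "upper n x = (\<lambda>p m. if p = m then 1 else if 1 \<le> p \<and> p < m \<and> m \<le> n then x (m, p, 0) else 0)"

definition tri_of :: "nat \<Rightarrow> (nat \<times> nat \<times> nat \<Rightarrow> complex) \<Rightarrow> sc" where
  "tri_of n x = (\<lambda>i j k. if 1 \<le> i \<and> 1 \<le> j \<and> max i j < k \<and> k \<le> n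
    then x (k, max i j, min i j) else 0)"

text \<open>The adjugate is the inverse here because the determinant is 1, which makes
  \<open>phi\<close> polynomial. The unipotent matrix is the inverse of the base change, not the
  base change itself.\<close>

definition phi :: "nat \<Rightarrow> (nat \<times> nat \<times> nat \<Rightarrow> complex) \<Rightarrow> sc" where
  "phi n x = act n (fadj n (upper n x)) (upper n x) (tri_of n x)"

lemma params_finite: "finite (params n)"
  unfolding params_def by auto

text \<open>For fixed j < k there are j structure constants c i j k with 1 <= i <= j and one matrix
  entry. The factors 2 and 6 avoid division in the inductions.\<close>

lemma params_card: "card (params n) = n * (n - 1) * (n + 4) div 6"
proof -
  have 1: "2 * (\<Sum>j\<in>{1..<k}. Suc j) = (k - 1) * (k + 2)" for k :: nat
  proof (induction k)
    case (Suc k)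
    then show ?case by (cases k) (auto simp: algebra_simps)
  qed simp
  have 2: "6 * (\<Sum>k\<in>{1..n}. \<Sum>j\<in>{1..<k}. Suc j) = n * (n - 1) * (n + 4)" for n :: nat
  proof (induction n)
    case (Suc n)
    have "6 * (\<Sum>k\<in>{1..Suc n}. \<Sum>j\<in>{1..<k}. Suc j)
      = 6 * (\<Sum>k\<in>{1..n}. \<Sum>j\<in>{1..<k}. Suc j) + 3 * (2 * (\<Sum>j\<in>{1..<Suc n}. Suc j))"
      by simp
    also have "\<dots> = n * (n - 1) * (n + 4) + 3 * (n * (n + 3))"
      unfolding Suc.IH 1 by (simp add: algebra_simps)
    also have "\<dots> = Suc n * (Suc n - 1) * (Suc n + 4)"
      by (cases n) (auto simp: algebra_simps)
    finally show ?case .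
  qed simp
  have "card (params n) = (\<Sum>k\<in>{1..n}. \<Sum>j\<in>{1..<k}. Suc j)"
    unfolding params_def by simp
  with 2[of n] show ?thesis by simp
qed

lemma fdet_upper: "fdet n (upper n x) = 1"
proof -
  have "upper_triangular (fmat n (upper n x))"
    unfolding upper_triangular_def fmat_def upper_def by auto
  then have "fdet n (upper n x) = prod_list (diag_mat (fmat n (upper n x)))"
    unfolding fdet_def by (rule det_upper_triangular[OF _ fmat_carrier])
  also have "diag_mat (fmat n (upper n x)) = map (\<lambda>_. 1) [0..<n]"
    unfolding diag_mat_def fmat_def upper_def by auto
  finally show ?thesis by (simp add: map_replicate_const prod_list_replicate)
qed

lemma inv_pair_upper: "inv_pair n (fadj n (upper n x)) (upper n x)"
  using inv_pairI_fdet[of n "upper n x"] inv_pair_commute by (simp add: fdet_upper)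

lemma tri_of_tri: "tri_of n x \<in> tri n"
  unfolding tri_of_def tri_def ambient_def commutative_alg_def by (auto simp: max.commute min.commute)

lemma phi_CNil: "phi n x \<in> CNil n"
  unfolding phi_def by (rule act_tri_CNil[OF inv_pair_upper tri_of_tri])

lemma phi_mpoly: "(\<lambda>x. phi n x i j k) \<in> mpoly (params n)"
proof -
  interpret fun_alg "mpoly (params n)" by (rule fun_alg_mpoly)
  have u: "(\<lambda>x. upper n x p m) \<in> mpoly (params n)" for p m
  proof (cases "p = m \<or> \<not> (1 \<le> p \<and> p < m \<and> m \<le> n)")
    case True
    then consider "p = m" | "p \<noteq> m" "\<not> (1 \<le> p \<and> p < m \<and> m \<le> n)" by blast
    then show ?thesis unfolding upper_def by cases (simp_all only: if_True if_False simp_thms const)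
  next
    case False
    then have "(m, p, 0) \<in> params n" unfolding params_def by auto
    then have "(\<lambda>x. x (m, p, 0)) \<in> mpoly (params n)" by (rule mp_var)
    then show ?thesis unfolding upper_def using False by simp
  qed
  have t: "(\<lambda>x. tri_of n x i j k) \<in> mpoly (params n)" for i j k
  proof (cases "1 \<le> i \<and> 1 \<le> j \<and> max i j < k \<and> k \<le> n")
    case True
    then have "(k, max i j, min i j) \<in> params n" unfolding params_def by auto
    then have "(\<lambda>x. x (k, max i j, min i j)) \<in> mpoly (params n)" by (rule mp_var)
    then show ?thesis unfolding tri_of_def using True by simp
  next
    case False
    then show ?thesis unfolding tri_of_def using const by (simp only: if_False)
  qed
  show ?thesis unfolding phi_def by (rule act[OF fadj[OF u] u t])
qed

lemma phi_surj:
  assumes "t \<in> tri n" "\<And>p. h p p = 1" "\<And>p m. m < p \<Longrightarrow> h p m = 0"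
  shows "\<exists>x. tri_of n x = t \<and> (\<forall>p\<in>{1..n}. \<forall>m\<in>{1..n}. upper n x p m = h p m)"
proof -
  define x where "x = (\<lambda>(k, j, i). if i = 0 then h j k else t i j k)"
  have "tri_of n x i j k = t i j k" for i j k
  proof (cases "1 \<le> i \<and> 1 \<le> j \<and> max i j < k \<and> k \<le> n")
    case True
    then have "tri_of n x i j k = t (min i j) (max i j) k" unfolding tri_of_def x_def by auto
    also have "\<dots> = t i j k"
      using assms(1) unfolding tri_def commutative_alg_def by (cases "i \<le> j") (simp_all add: max_def min_def)
    finally show ?thesis .
  next
    case False
    then have "k \<le> max i j \<or> \<not> (i \<in> {1..n} \<and> j \<in> {1..n} \<and> k \<in> {1..n})" by auto
    then have "t i j k = 0" using assms(1) unfolding tri_def ambient_def by blast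
    then show ?thesis using False unfolding tri_of_def by (simp only: if_False)
  qed
  moreover have "upper n x p m = h p m" if "p \<in> {1..n}" "m \<in> {1..n}" for p m
    using that assms(2,3) unfolding upper_def x_def by auto
  ultimately show ?thesis by blast
qed

lemma act_entry:
  assumes "i \<in> {1..n}" "j \<in> {1..n}" "k \<in> {1..n}"
  shows "act n g h c i j k = mv n h (amult n c (mv n g (unitv i)) (mv n g (unitv j))) k"
  using amult_unitv[OF assms, of "act n g h c"] by (simp only: amult_act)

text \<open>Membership in \<open>tri n\<close> depends only on the flag of the spans of e_j, ...,
  e_n, and lower triangular matrices preserve this flag.\<close>

lemma act_lower_tri:
  assumes "t \<in> tri n"
    and "\<And>r m. r \<in> {1..n} \<Longrightarrow> m \<in> {1..n} \<Longrightarrow> r < m \<Longrightarrow> b r m = 0"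
    and "\<And>r m. r \<in> {1..n} \<Longrightarrow> m \<in> {1..n} \<Longrightarrow> r < m \<Longrightarrow> b' r m = 0"
  shows "act n b b' t \<in> tri n"
proof -
  have tc: "commutative_alg (act n b b' t)"
    using assms(1) act_commutative unfolding tri_def by blast
  have t0: "act n b b' t i j k = 0" if "k \<le> j" for i j k
  proof (cases "i \<in> {1..n} \<and> j \<in> {1..n} \<and> k \<in> {1..n}")
    case True
    let ?z = "amult n t (mv n b (unitv i)) (mv n b (unitv j))"
    have "mv n b (unitv j) l = 0" if "l < j" for l
    proof (cases "l \<in> {1..n}")
      case l: True
      then show ?thesis using True assms(2)[OF l _ that] by (simp add: mv_unitv)
    next
      case False
      then show ?thesis by (rule vecsD[OF mv_vecs])
    qed
    then have z: "?z l = 0" if "l \<le> j" for l using tri_amult_zero(1)[OF assms(1) _ that] by blast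
    have "act n b b' t i j k = mv n b' ?z k"
      using True by (intro act_entry) simp_all
    also have "\<dots> = (\<Sum>l\<in>{1..n}. b' k l * ?z l)" using True unfolding mv_def by simp
    also have "\<dots> = 0"
    proof (intro sum.neutral ballI)
      fix l assume l: "l \<in> {1..n}"
      show "b' k l * ?z l = 0"
      proof (cases "l \<le> j")
        case False
        then have "b' k l = 0" using True l that by (intro assms(3)) auto
        then show ?thesis by simp
      qed (simp add: z)
    qed
    finally show ?thesis .
  next
    case False
    then show ?thesis unfolding act_def by auto
  qed
  have "act n b b' t i j k = 0" if "k \<le> max i j" for i j k
  proof (cases "k \<le> j")
    case False
    then have "act n b b' t j i k = 0" using that by (intro t0) simp
    then show ?thesis using tc unfolding commutative_alg_def by simp
  qed (rule t0)
  then show ?thesis using tc act_ambient unfolding tri_def by blast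
qed

text \<open>Columns are treated from the last to the first: for i <= m, the entry (i, m) of the
  product b' b reduces to b' i m * b m m. The scalar d admits adjugates as well as inverses.\<close>

lemma inverse_lower:
  fixes b b' :: "nat \<Rightarrow> nat \<Rightarrow> complex"
  assumes "d \<noteq> 0"
    and "\<And>r m. r \<in> {1..n} \<Longrightarrow> m \<in> {1..n} \<Longrightarrow> r < m \<Longrightarrow> b r m = 0"
    and "\<And>r m. r \<in> {1..n} \<Longrightarrow> m \<in> {1..n} \<Longrightarrow> (\<Sum>l\<in>{1..n}. b' r l * b l m) = (if r = m then d else 0)"
  shows "m \<in> {1..n} \<Longrightarrow> r \<in> {1..n} \<Longrightarrow> r < m \<Longrightarrow> b' r m = 0"
proof (induction "n - m" arbitrary: m r rule: less_induct)
  case less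
  have eq: "(\<Sum>l\<in>{1..n}. b' i l * b l m) = b' i m * b m m" if i: "i \<in> {1..n}" "i \<le> m" for i
  proof -
    have "b' i l * b l m = 0" if "l \<in> {1..n} - {m}" for l
    proof (cases "l < m")
      case True
      then have "b l m = 0" using that less.prems by (intro assms(2)) auto
      then show ?thesis by simp
    next
      case False
      then have "m < l" using that by auto
      then have "b' i l = 0" using that i less.prems by (intro less.hyps) auto
      then show ?thesis by simp
    qed
    then have "(\<Sum>l\<in>{1..n} - {m}. b' i l * b l m) = 0" by (intro sum.neutral) blast
    then show ?thesis using less.prems(1) by (subst sum.remove[of _ m]) simp_all
  qed
  have "b' m m * b m m = d" using eq[of m] assms(3)[of m m] less.prems by simp
  then have "b m m \<noteq> 0" using assms(1) by auto
  moreover have "b' r m * b m m = 0" using eq[of r] assms(3)[of r m] less.prems by simp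
  ultimately show ?case by simp
qed

lemma fadj_corner: "1 \<le> m \<Longrightarrow> fadj m g m m = fdet (m - 1) g"
proof -
  assume m: "1 \<le> m"
  have "mat_delete (fmat m g) (m - 1) (m - 1) = fmat (m - 1) g"
    unfolding mat_delete_def fmat_def by (rule eq_matI) (use m in auto)
  then show ?thesis unfolding fadj_def cofactor_def fdet_def by simp
qed

text \<open>If the leading principal minors of \<open>g\<close> do not vanish, then \<open>g\<close> is the product of a lower
  triangular matrix, which preserves \<open>tri\<close>, and a unipotent upper triangular one. The columns of the
  inverse of the latter are multiples of the last columns of the adjugates of the leading blocks.\<close>
lemma act_in_range_phi:
  assumes minors: "\<And>m. m \<le> n \<Longrightarrow> fdet m g \<noteq> 0" and t: "t \<in> tri n"
  shows "act n g (fadj n g) t \<in> range (phi n)"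
proof -
  define h0 where "h0 l m = (if l = m then 1 else if l < m then fadj m g l m / fadj m g m m else 0)" for l m
  have h01: "h0 p p = 1" "m < p \<Longrightarrow> h0 p m = 0" for p m unfolding h0_def by auto
  define d where "d = fdet n g"
  have d: "d \<noteq> 0" unfolding d_def using minors by simp
  obtain x where x: "\<forall>p\<in>{1..n}. \<forall>m\<in>{1..n}. upper n x p m = h0 p m"
    using phi_surj[of "tri_of n undefined" n h0] h01 tri_of_tri by blast
  define h where "h = upper n x"
  define hi where "hi = fadj n h"
  have hih: "inv_pair n hi h" unfolding h_def hi_def by (rule inv_pair_upper)
  \<comment> \<open>The factorisation is g = b hi, and correspondingly the adjugate of g is h b'.
    Thus b' is inverse to b only up to the factor d.\<close>
  define b where "b = mmul n g h"
  define b' where "b' = mmul n hi (fadj n g)"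
  have gh0: "b r m = 0" if rm: "r \<in> {1..n}" "m \<in> {1..n}" "r < m" for r m
  proof -
    have c: "fadj m g m m \<noteq> 0" using fadj_corner[of m g] minors[of "m - 1"] rm by auto
    have "b r m = (\<Sum>l\<in>{1..n}. g r l * h0 l m)"
      unfolding b_def mmul_def h_def using x rm by (intro sum.cong) auto
    also have "\<dots> = (\<Sum>l\<in>{1..m}. g r l * h0 l m)"
      using rm by (intro sum.mono_neutral_right) (auto simp: h0_def)
    also have "\<dots> = (\<Sum>l\<in>{1..m}. g r l * fadj m g l m) / fadj m g m m"
      unfolding sum_divide_distrib using c by (intro sum.cong) (auto simp: h0_def)
    also have "\<dots> = 0" using fadj_mult(1)[of r m m g] rm by simp
    finally show ?thesis .
  qed
  have adjg: "mv n (fadj n g) (mv n g z) = (\<lambda>k. d * z k)" if "z \<in> vecs n" for z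
    unfolding mv_mmul[symmetric] d_def by (rule mv_delta[OF _ that]) (simp add: mmul_def fadj_mult(2))
  have b'b: "(\<Sum>l\<in>{1..n}. b' r l * b l m) = (if r = m then d else 0)" if "r \<in> {1..n}" "m \<in> {1..n}" for r m
  proof -
    have "(\<Sum>l\<in>{1..n}. b' r l * b l m) = mv n (mmul n b' b) (unitv m) r"
      using that by (simp only: mv_unitv mmul_def)
    also have "mv n (mmul n b' b) (unitv m) = mv n hi (mv n (fadj n g) (mv n g (mv n h (unitv m))))"
      by (simp only: mv_mmul b'_def b_def)
    also have "\<dots> = (\<lambda>k. d * unitv m k)"
      using adjg[OF mv_vecs] inv_pair_mv[OF hih unitv_vecs[OF that(2)]] by (simp add: mv_smult)
    finally show ?thesis by (simp add: unitv_def)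
  qed
  have b'0: "b' r m = 0" if "r \<in> {1..n}" "m \<in> {1..n}" "r < m" for r m
    by (rule inverse_lower[OF d gh0 b'b that(2,1,3)])
  have T: "act n b b' t \<in> tri n" by (rule act_lower_tri[OF t gh0 b'0])
  have "act n g (fadj n g) t = act n hi h (act n b b' t)"
  proof (rule sc_eqI[OF act_ambient act_ambient])
    fix i j assume ij: "i \<in> {1..n}" "j \<in> {1..n}"
    have u: "mv n b (mv n hi (unitv i)) = mv n g (unitv i)" if "i \<in> {1..n}" for i
      unfolding b_def mv_mmul inv_pair_mv[OF inv_pair_commute[OF hih] unitv_vecs[OF that]] ..
    have v: "mv n h (mv n b' z) = mv n (fadj n g) z" for z
      unfolding b'_def mv_mmul inv_pair_mv[OF inv_pair_commute[OF hih] mv_vecs] ..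
    show "amult n (act n g (fadj n g) t) (unitv i) (unitv j) =
        amult n (act n hi h (act n b b' t)) (unitv i) (unitv j)"
      unfolding amult_act u[OF ij(1)] u[OF ij(2)] v ..
  qed
  also obtain y where y: "tri_of n y = act n b b' t" "\<forall>p\<in>{1..n}. \<forall>m\<in>{1..n}. upper n y p m = h0 p m"
    using phi_surj[OF T, of h0] h01 by blast
  \<comment> \<open>The matrices \<open>upper n y\<close> and h are known to agree only within 1..n,
    so the maps \<open>mv\<close> are compared; the adjugates then agree as inverses of the same
    map.\<close>
  have "phi n y = act n hi h (act n b b' t)"
  proof -
    have hy: "mv n (upper n y) = mv n h" unfolding h_def by (rule mv_cong) (use x y in simp)
    have "mv n (fadj n (upper n y)) z = mv n hi z" if "z \<in> vecs n" for z
    proof -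
      have "z = mv n h (mv n hi z)" using inv_pair_mv[OF inv_pair_commute[OF hih] that] by simp
      also have "\<dots> = mv n (upper n y) (mv n hi z)" unfolding hy ..
      finally show ?thesis using inv_pair_mv[OF inv_pair_upper mv_vecs] by metis
    qed
    then show ?thesis unfolding phi_def y(1)
      by (intro sc_eqI[of _ n] act_ambient) (simp add: amult_act hy unitv_vecs del: atLeastAtMost_iff)
  qed
  ultimately show ?thesis by (metis rangeI)
qed

lemma inv_pair_fdet:
  assumes "inv_pair n g h"
  shows "fdet n g \<noteq> 0"
proof
  assume "fdet n g = 0"
  then obtain v where v: "v \<in> vecs n" "v \<noteq> (\<lambda>_. 0)" "\<forall>i\<in>{1..n}. (\<Sum>j\<in>{1..n}. g i j * v j) = 0"
    unfolding fdet_eq_0_iff by blast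
  then have "mv n g v = (\<lambda>_. 0)" unfolding mv_def by auto
  then have "v = (\<lambda>_. 0)" using inv_pair_mv[OF inv_pair_commute[OF assms] v(1)] mv_zero by metis
  with v(2) show False by simp
qed

lemma fdet_identity: "fdet n (\<lambda>i j. if i = j then 1 else 0) = 1"
proof -
  have "fmat n (\<lambda>i j. if i = j then 1 else 0) = 1\<^sub>m n"
    unfolding fmat_def by (rule eq_matI) auto
  then show ?thesis unfolding fdet_def by simp
qed

lemma amult_scale: "amult n (\<lambda>i j k. a * c i j k) x y = (\<lambda>l. a * amult n c x y l)"
  unfolding amult_def by (auto simp: fun_eq_iff sum_distrib_left algebra_simps)

lemma tri_scale: "t \<in> tri n \<Longrightarrow> (\<lambda>i j k. a * t i j k) \<in> tri n"
  unfolding tri_def ambient_def commutative_alg_def by auto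

lemma range_phi_ambient: "range (phi n) \<subseteq> ambient n"
  using phi_CNil unfolding CNil_def by blast

text \<open>An arbitrary invertible \<open>g\<close> is joined to the identity by a line, whose generic point has
  nonvanishing leading principal minors. The inverse is replaced by the adjugate, which is polynomial
  along this line; the scalar factor between them is absorbed by \<open>tri\<close>.\<close>
lemma CNil_closure: "CNil n = zar_closure n (range (phi n))"
proof
  show "zar_closure n (range (phi n)) \<subseteq> CNil n"
    by (rule zar_closure_minimal[OF CNil_closed]) (use phi_CNil in blast)
  show "CNil n \<subseteq> zar_closure n (range (phi n))"
  proof
    fix c assume "c \<in> CNil n"
    then obtain g h t0 where ght: "inv_pair n g h" "t0 \<in> tri n" "c = act n g h t0"
      using CNil_act_tri by blast
    define d where "d = fdet n g"
    have d: "d \<noteq> 0" unfolding d_def by (rule inv_pair_fdet[OF ght(1)])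
    define t where "t = (\<lambda>i j k. inverse d * t0 i j k)"
    have t: "t \<in> tri n" unfolding t_def by (rule tri_scale[OF ght(2)])
    have adj: "mv n (fadj n g) z = (\<lambda>k. d * mv n h z k)" if "z \<in> vecs n" for z
    proof -
      have "mv n g (mv n (fadj n g) z) = (\<lambda>k. d * z k)"
        unfolding mv_mmul[symmetric] d_def by (rule mv_delta[OF _ that]) (simp add: mmul_def fadj_mult(1))
      then have "mv n h (mv n g (mv n (fadj n g) z)) = (\<lambda>k. d * mv n h z k)" by (simp only: mv_smult)
      then show ?thesis using inv_pair_mv[OF inv_pair_commute[OF ght(1)] mv_vecs] by simp
    qed
    have c: "c = act n g (fadj n g) t"
      unfolding ght(3)
      by (rule sc_eqI[OF act_ambient act_ambient])
        (use d in \<open>simp add: amult_act t_def amult_scale mv_smult adj[OF amult_vecs] mult.assoc[symmetric]\<close>)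
    define gs where "gs s = (\<lambda>i j. g i j + s * ((if i = j then 1 else 0) - g i j))" for s :: complex
    define \<psi> where "\<psi> s = act n (gs s) (fadj n (gs s)) t" for s
    interpret fun_alg upoly by (rule fun_alg_upoly)
    have gs: "(\<lambda>s. gs s i j) \<in> upoly" for i j
      unfolding gs_def by (intro add mult const upoly_id)
    have \<psi>: "(\<lambda>s. \<psi> s i j k) \<in> upoly" for i j k
      unfolding \<psi>_def by (rule act[OF gs fadj[OF gs] const])
    define \<Delta> where "\<Delta> s = (\<Prod>m\<in>{..n}. fdet m (gs s))" for s
    have \<Delta>: "\<Delta> \<in> upoly" unfolding \<Delta>_def by (intro prod fdet gs)
    have "gs 1 = (\<lambda>i j. if i = j then 1 else 0)" "gs 0 = g" unfolding gs_def by (auto simp: fun_eq_iff)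
    then have \<Delta>1: "\<Delta> 1 \<noteq> 0" and \<psi>0: "\<psi> 0 = c" unfolding \<Delta>_def \<psi>_def c by (simp_all add: fdet_identity)
    have "f c = 0" if f: "f \<in> poly_fun n" "\<forall>x\<in>range (phi n). f x = 0" for f
    proof (rule ccontr)
      assume "f c \<noteq> 0"
      then have "f (\<psi> 0) \<noteq> 0" unfolding \<psi>0 .
      with \<Delta>1 obtain s where s: "\<Delta> s \<noteq> 0" "f (\<psi> s) \<noteq> 0"
        by (rule upoly_no_zero_divisors[OF \<Delta> poly_fun_comp[OF f(1), of \<psi>, OF \<psi>]])
      have "\<psi> s \<in> range (phi n)"
        unfolding \<psi>_def by (rule act_in_range_phi[OF _ t]) (use s(1) in \<open>auto simp: \<Delta>_def\<close>)
      with f(2) s(2) show False by blast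
    qed
    moreover have "c \<in> ambient n" unfolding ght(3) by (rule act_ambient)
    ultimately show "c \<in> zar_closure n (range (phi n))"
      unfolding zar_closure_eq[OF range_phi_ambient] by blast
  qed
qed

section \<open>A chain of maximal length\<close>

text \<open>The structure constants come first, then the entries of the unipotent matrix column by column,
  each column being read upwards from the diagonal.\<close>
definition key :: "nat \<Rightarrow> nat \<times> nat \<times> nat \<Rightarrow> nat" where
  "key n = (\<lambda>(k, j, i). if 1 \<le> i then (i * (n + 1) + j) * (n + 1) + k
    else ((n + 1) * (n + 1) + k) * (n + 1) + (n - j))"

lemma digits_less:
  fixes a b a' b' M :: nat
  assumes "b < M" "a < a'"
  shows "a * M + b < a' * M + b'"
proof -
  have "a * M + b < Suc a * M" using assms(1) by simp
  also have "\<dots> \<le> a' * M" using assms(2) by (intro mult_right_mono) auto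
  finally show ?thesis by simp
qed

lemma digits_eq:
  fixes a b a' b' M :: nat
  assumes "a * M + b = a' * M + b'" "b < M" "b' < M"
  shows "a = a'" "b = b'"
  using digits_less[of b M a a' b'] digits_less[of b' M a' a b] assms
  by (metis nat_neq_iff, metis add_left_cancel nat_neq_iff)

text \<open>The offset (n + 1) * (n + 1) in \<open>key\<close> exceeds every i * (n + 1) + j with i,
  j <= n, so it separates the two kinds of parameters.\<close>

lemma key_tri_less:
  assumes "(k, j, i) \<in> params n" "1 \<le> i" "(k', j', 0) \<in> params n"
  shows "key n (k, j, i) < key n (k', j', 0)"
proof -
  have "i * (n + 1) + j < (n + 1) * (n + 1) + k'"
    using digits_less[of j "n + 1" i "n + 1" k'] assms(1) unfolding params_def by simp
  then show ?thesis
    using assms(1,2) digits_less[of k "n + 1" "i * (n + 1) + j" "(n + 1) * (n + 1) + k'"]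
    unfolding key_def params_def by simp
qed

lemma key_upper_less:
  assumes "(k, j, 0) \<in> params n" "(k', j', 0) \<in> params n" "k < k' \<or> k = k' \<and> j' \<le> j"
  shows "key n (k, j, 0) \<le> key n (k', j', 0)"
proof -
  have key0: "key n (k, j, 0) = ((n + 1) * (n + 1) + k) * (n + 1) + (n - j)" for k j
    unfolding key_def by simp
  show ?thesis
  proof (cases "k < k'")
    case True
    then have lt: "(n + 1) * (n + 1) + k < (n + 1) * (n + 1) + k'" by simp
    show ?thesis unfolding key0 by (rule less_imp_le, rule digits_less[OF _ lt]) simp
  next
    case False
    then show ?thesis using assms(3) unfolding key0 by (intro add_mono) auto
  qed
qed

lemma key_inj: "inj_on (key n) (params n)"
proof (rule inj_onI)
  fix v v' assume v: "v \<in> params n" "v' \<in> params n" "key n v = key n v'"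
  obtain k j i k' j' i' where vv: "v = (k, j, i)" "v' = (k', j', i')"
    by (cases v, cases v')
  have b: "i \<le> j" "j < n + 1" "k < n + 1" "i' \<le> j'" "j' < n + 1" "k' < n + 1"
    using v(1,2) unfolding vv params_def by auto
  show "v = v'"
  proof (cases "1 \<le> i")
    case True
    then have i': "1 \<le> i'" using key_tri_less[of k j i n k' j'] v unfolding vv by (cases "i' = 0") auto
    then have "(i * (n + 1) + j) * (n + 1) + k = (i' * (n + 1) + j') * (n + 1) + k'"
      using v(3) True unfolding vv key_def by simp
    with digits_eq[OF this b(3,6)] digits_eq[of i "n + 1" j i' j'] b show ?thesis unfolding vv by simp
  next
    case False
    then have i: "i = 0" by simp
    then have i': "i' = 0" using key_tri_less[of k' j' i' n k j] v unfolding vv by (cases "i' = 0") auto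
    have "((n + 1) * (n + 1) + k) * (n + 1) + (n - j) = ((n + 1) * (n + 1) + k') * (n + 1) + (n - j')"
      using v(3) i i' unfolding vv key_def by simp
    with digits_eq[OF this] b show ?thesis unfolding vv i i' by simp
  qed
qed

definition cut :: "nat \<Rightarrow> nat \<Rightarrow> (nat \<times> nat \<times> nat \<Rightarrow> complex) \<Rightarrow> nat \<times> nat \<times> nat \<Rightarrow> complex" where
  "cut n N x = (\<lambda>v. if v \<in> params n \<and> key n v < N then x v else 0)"

lemma phi_tri:
  assumes "\<And>k j. (k, j, 0) \<in> params n \<Longrightarrow> x (k, j, 0) = 0"
  shows "phi n x = tri_of n x"
proof -
  have u: "upper n x p m = (if p = m then 1 else 0)" for p m
    unfolding upper_def using assms[of m p] unfolding params_def by auto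
  have h: "mv n (upper n x) z = z" if "z \<in> vecs n" for z
    using mv_delta[of n "upper n x" 1 z] u that by simp
  have g: "mv n (fadj n (upper n x)) z = z" if "z \<in> vecs n" for z
    using inv_pair_mv[OF inv_pair_upper that, of x] h[OF that] by simp
  have a: "tri_of n x \<in> ambient n" using tri_of_tri unfolding tri_def by blast
  show ?thesis
    unfolding phi_def
    by (rule sc_eqI[OF act_ambient a]) (simp add: amult_act h g amult_vecs unitv_vecs del: atLeastAtMost_iff)
qed

text \<open>Up to this key all matrix entries are 0, the unipotent matrix is the identity, and the
  coordinate c i j k is the parameter itself.\<close>

lemma separate_tri_param:
  assumes v: "(k, j, i) \<in> params n" "1 \<le> i"
  shows "\<exists>g\<in>poly_fun n. (\<forall>x. g (phi n (cut n (key n (k, j, i)) x)) = 0) \<and>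
    (\<exists>x. g (phi n (cut n (Suc (key n (k, j, i))) x)) \<noteq> 0)"
proof -
  have ijk: "1 \<le> i" "i \<le> j" "j < k" "k \<le> n" using v unfolding params_def by auto
  have p: "phi n (cut n N x) i j k = cut n N x (k, j, i)" if "N \<le> Suc (key n (k, j, i))" for N x
  proof -
    have "phi n (cut n N x) = tri_of n (cut n N x)"
    proof (rule phi_tri)
      fix k' j' assume "(k', j', 0) \<in> params n"
      from key_tri_less[OF v this] that show "cut n N x (k', j', 0) = 0" unfolding cut_def by auto
    qed
    then show ?thesis using ijk unfolding tri_of_def by simp
  qed
  show ?thesis
  proof (intro bexI conjI allI)
    show "(\<lambda>c. c i j k) \<in> poly_fun n" using ijk by (intro pf_coord) auto
    show "phi n (cut n (key n (k, j, i)) x) i j k = 0" for x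
      by (subst p) (simp_all add: cut_def)
    have "phi n (cut n (Suc (key n (k, j, i))) (\<lambda>_. 1)) i j k = 1"
      by (subst p) (use v in \<open>simp_all add: cut_def\<close>)
    then show "\<exists>x. phi n (cut n (Suc (key n (k, j, i))) x) i j k \<noteq> 0" by (metis one_neq_zero)
  qed
qed

lemma amult_unitv_left:
  assumes "i \<in> {1..n}" "k \<in> {1..n}"
  shows "amult n c (unitv i) y k = (\<Sum>q\<in>{1..n}. c i q k * y q)"
proof -
  have "amult n c (unitv i) y k = (\<Sum>p\<in>{1..n}. (\<Sum>q\<in>{1..n}. c p q k * y q) * unitv i p)"
    using assms unfolding amult_def by (simp add: sum_distrib_right sum_distrib_left algebra_simps)
  then show ?thesis using sum_unitv[OF _ assms(1)] by simp
qed

text \<open>The test function for the entry \<open>(p, m)\<close> of the unipotent factor \<open>h\<close>. If only the entries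
  of column \<open>m\<close> below \<open>p\<close> and the columns before \<open>m\<close> are nonzero, then column \<open>m\<close> of \<open>h\<close> annihilates
  the algebra modulo the last \<open>n - m\<close> basis vectors, which gives a relation between the columns
  \<open>p + 1, \<dots>, m\<close> of the matrix \<open>(c i q m)\<close>.\<close>
lemma separate_upper_param:
  assumes v: "(m, p, 0) \<in> params n"
  shows "\<exists>f\<in>poly_fun n. (\<forall>x. f (phi n (cut n (key n (m, p, 0)) x)) = 0) \<and>
    (\<exists>x. f (phi n (cut n (Suc (key n (m, p, 0))) x)) \<noteq> 0)"
proof -
  have pm: "1 \<le> p" "p < m" "m \<le> n" using v unfolding params_def by auto
  define d where "d = m - p"
  have d: "1 \<le> d" "p + d = m" unfolding d_def using pm by auto
  \<comment> \<open>Rows are i = p, ..., m - 1 and columns q = p + 1, ..., m. The kernel relation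
    holds for every row i; this choice of rows makes the matrix invertible at the test point
    below.\<close>
  define A where "A c = (\<lambda>a b. c (p + a - 1) (p + b) m :: complex)" for c :: sc
  define f where "f c = fdet d (A c)" for c
  interpret fun_alg "poly_fun n" by (rule fun_alg_poly_fun)
  have "f \<in> poly_fun n"
    unfolding f_def A_def by (intro fdet pf_coord) (use pm d in auto)
  moreover have "f (phi n (cut n (key n (m, p, 0)) x)) = 0" for x
  proof -
    define y where "y = cut n (key n (m, p, 0)) x"
    define h where "h = upper n y"
    have hcol: "h l m = 0" if "1 \<le> l" "l \<le> p" for l
    proof -
      have w: "(m, l, 0) \<in> params n" using that pm unfolding params_def by auto
      have "\<not> key n (m, l, 0) < key n (m, p, 0)" using key_upper_less[OF v w] that by simp
      then show ?thesis unfolding h_def upper_def y_def cut_def using that pm by simp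
    qed
    have hrow: "h m l = 0" if "m < l" "l \<le> n" for l
    proof -
      have w: "(l, m, 0) \<in> params n" using that pm unfolding params_def by auto
      have "\<not> key n (l, m, 0) < key n (m, p, 0)" using key_upper_less[OF v w] that by simp
      then show ?thesis unfolding h_def upper_def y_def cut_def using that pm by simp
    qed
    have hlow: "h l q = 0" if "q < l" for l q using that unfolding h_def upper_def by auto
    have hmm: "h m m = 1" unfolding h_def upper_def by simp
    let ?g = "fadj n h" and ?t = "tri_of n y"
    have gh: "inv_pair n ?g h" unfolding h_def by (rule inv_pair_upper)
    have key0: "(\<Sum>b\<in>{1..d}. phi n y i (p + b) m * h (p + b) m) = 0" if i: "i \<in> {1..n}" for i
    proof -
      have "(\<Sum>b\<in>{1..d}. phi n y i (p + b) m * h (p + b) m) = (\<Sum>q\<in>{p+1..m}. phi n y i q m * h q m)"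
        using d by (intro sum.reindex_bij_witness[of _ "\<lambda>q. q - p" "\<lambda>b. p + b"]) auto
      also have "\<dots> = (\<Sum>q\<in>{1..n}. phi n y i q m * h q m)"
      proof (rule sum.mono_neutral_left)
        show "\<forall>q\<in>{1..n} - {p + 1..m}. phi n y i q m * h q m = 0"
        proof
          fix q assume q: "q \<in> {1..n} - {p + 1..m}"
          have "h q m = 0"
          proof (cases "q \<le> p")
            case True
            then show ?thesis using q by (intro hcol) auto
          next
            case False
            then show ?thesis using q by (intro hlow) auto
          qed
          then show "phi n y i q m * h q m = 0" by simp
        qed
      qed (use pm in auto)
      also have "\<dots> = (\<Sum>q\<in>{1..n}. phi n y i q m * mv n h (unitv m) q)"
        using pm by (intro sum.cong) (auto simp: mv_unitv)
      also have "\<dots> = amult n (phi n y) (unitv i) (mv n h (unitv m)) m"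
        using i pm by (intro amult_unitv_left[symmetric]) auto
      also have "\<dots> = mv n h (amult n ?t (mv n ?g (unitv i)) (mv n ?g (mv n h (unitv m)))) m"
        unfolding phi_def h_def[symmetric] amult_act ..
      also have "mv n ?g (mv n h (unitv m)) = unitv m"
        using pm by (intro inv_pair_mv[OF gh] unitv_vecs) auto
      also have "mv n h (amult n ?t (mv n ?g (unitv i)) (unitv m)) m = 0"
      proof -
        let ?z = "amult n ?t (mv n ?g (unitv i)) (unitv m)"
        have z: "?z l = 0" if "l \<le> m" for l
          by (rule tri_amult_zero(1)[OF tri_of_tri _ that]) (simp add: unitv_def)
        have "h m l * ?z l = 0" if "l \<in> {1..n}" for l
          using z[of l] hrow[of l] that by (cases "l \<le> m") auto
        then have "(\<Sum>l\<in>{1..n}. h m l * ?z l) = 0" by (intro sum.neutral) blast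
        then show ?thesis unfolding mv_def[of n h] by (simp only: if_cancel)
      qed
      finally show ?thesis .
    qed
    define w where "w b = (if b \<in> {1..d} then h (p + b) m else 0)" for b
    have "w \<in> vecs d" unfolding w_def vecs_def by simp
    moreover have "w d \<noteq> 0" unfolding w_def using d hmm by simp
    then have "w \<noteq> (\<lambda>_. 0)" by auto
    moreover have "(\<Sum>b\<in>{1..d}. A (phi n y) a b * w b) = 0" if "a \<in> {1..d}" for a
    proof -
      have "(\<Sum>b\<in>{1..d}. A (phi n y) a b * w b) = (\<Sum>b\<in>{1..d}. phi n y (p + a - 1) (p + b) m * h (p + b) m)"
        unfolding A_def w_def by (intro sum.cong) auto
      moreover have "p + a - 1 \<in> {1..n}" using that pm d by auto
      ultimately show ?thesis using key0 by simp
    qed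
    ultimately show ?thesis unfolding f_def y_def[symmetric] fdet_eq_0_iff by blast
  qed
  \<comment> \<open>At the test point, coordinate m of a product is the standard bilinear form on
    e_1, ..., e_(m-1), and the base change only replaces e_m by e_m - e_p. So A becomes a cyclic
    permutation matrix with one sign changed.\<close>
  moreover have "f (phi n (cut n (Suc (key n (m, p, 0))) x)) \<noteq> 0"
    if x: "x = (\<lambda>(k, j, i). if i = 0 \<and> k = m \<and> j = p \<or> 1 \<le> i \<and> i = j \<and> k = m then 1 else 0)" for x
  proof -
    define y where "y = cut n (Suc (key n (m, p, 0))) x"
    have yx: "y v = x v" if "v \<in> params n" for v
    proof (cases v)
      case (fields k j i)
      show ?thesis
      proof (cases "1 \<le> i")
        case True
        then show ?thesis using key_tri_less[of k j i n m p] v that unfolding fields y_def cut_def by auto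
      next
        case False
        then have "i = 0" by simp
        then show ?thesis using that unfolding fields y_def cut_def x by auto
      qed
    qed
    define h where "h = upper n y"
    let ?g = "fadj n h" and ?t = "tri_of n y"
    have gh: "inv_pair n ?g h" unfolding h_def by (rule inv_pair_upper)
    have h: "h q r = (if q = r then 1 else if q = p \<and> r = m then 1 else 0)" for q r
    proof (cases "1 \<le> q \<and> q < r \<and> r \<le> n")
      case True
      then have "(r, q, 0) \<in> params n" unfolding params_def by auto
      then show ?thesis using True yx[of "(r, q, 0)"] unfolding h_def upper_def x by auto
    next
      case False
      then show ?thesis using pm unfolding h_def upper_def by auto
    qed
    have t: "?t q r m = (if q = r \<and> 1 \<le> q \<and> q < m then 1 else 0)" for q r
    proof (cases "1 \<le> q \<and> 1 \<le> r \<and> max q r < m")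
      case True
      then have "(m, max q r, min q r) \<in> params n" using pm unfolding params_def by auto
      then show ?thesis using True pm yx[of "(m, max q r, min q r)"] unfolding tri_of_def x by auto
    next
      case False
      then show ?thesis using pm unfolding tri_of_def by auto
    qed
    have hu: "mv n h (unitv q) = (if q = m then (\<lambda>k. unitv m k + unitv p k) else unitv q)" if "q \<in> {1..n}" for q
    proof (rule vecs_eqI[OF mv_vecs])
      show "(if q = m then (\<lambda>k. unitv m k + unitv p k) else unitv q) \<in> vecs n"
        using that pm unfolding vecs_def unitv_def by auto
      fix k assume "k \<in> {1..n}"
      then have "mv n h (unitv q) k = h k q" using that by (intro mv_unitv)
      then show "mv n h (unitv q) k = (if q = m then (\<lambda>k. unitv m k + unitv p k) else unitv q) k"
        using pm by (simp add: h unitv_def)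
    qed
    have gu: "mv n ?g (unitv q) = unitv q" if "q \<in> {1..n}" "q \<noteq> m" for q
      using inv_pair_mv[OF gh unitv_vecs[OF that(1)]] hu[OF that(1)] that(2) by simp
    have gm: "mv n ?g (unitv m) = (\<lambda>k. unitv m k + (- 1) * unitv p k)"
    proof -
      have m: "m \<in> {1..n}" and p: "p \<in> {1..n}" "p \<noteq> m" using pm by auto
      have "unitv m = mv n ?g (mv n h (unitv m))" using inv_pair_mv[OF gh unitv_vecs[OF m]] by simp
      also have "\<dots> = (\<lambda>k. mv n ?g (unitv m) k + unitv p k)"
        using hu[OF m] gu[OF p] by (simp add: mv_add)
      finally have "unitv m k = mv n ?g (unitv m) k + unitv p k" for k by (rule fun_cong)
      then show ?thesis by (simp add: fun_eq_iff)
    qed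
    have hz: "mv n h z m = z m" for z
    proof -
      have "mv n h z m = (\<Sum>l\<in>{1..n}. h m l * z l)" using pm unfolding mv_def by simp
      also have "\<dots> = (\<Sum>l\<in>{1..n}. if l = m then z m else 0)"
        using pm by (intro sum.cong) (auto simp: h)
      finally show ?thesis using pm by simp
    qed
    have entry: "phi n y i q m = (if q = m then (if i = p then - 1 else 0) else (if i = q then 1 else 0))"
      if i: "p \<le> i" "i < m" and q: "p < q" "q \<le> m" for i q
    proof -
      have in_n: "i \<in> {1..n}" "q \<in> {1..n}" "m \<in> {1..n}" "p \<in> {1..n}" using i q pm by auto
      have "phi n y i q m = amult n ?t (mv n ?g (unitv i)) (mv n ?g (unitv q)) m"
        unfolding phi_def h_def[symmetric] using act_entry[OF in_n(1,2,3), of ?g h ?t] hz by simp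
      also have "\<dots> = amult n ?t (unitv i) (mv n ?g (unitv q)) m"
        using gu[OF in_n(1)] i by simp
      also have "\<dots> = (if q = m then (if i = p then - 1 else 0) else (if i = q then 1 else 0))"
      proof (cases "q = m")
        case True
        have "amult n ?t (unitv i) (mv n ?g (unitv q)) m = ?t i m m + (- 1) * ?t i p m"
          unfolding True gm amult_add_right amult_smult_right
          using in_n by (simp add: amult_unitv del: atLeastAtMost_iff)
        then show ?thesis using True i pm by (simp add: t)
      next
        case False
        have "amult n ?t (unitv i) (mv n ?g (unitv q)) m = ?t i q m"
          using gu[OF in_n(2) False] in_n by (simp add: amult_unitv del: atLeastAtMost_iff)
        then show ?thesis using False i pm by (simp add: t)
      qed
      finally show ?thesis .
    qed
    have A: "A (phi n y) a b = (if b = d then (if a = 1 then - 1 else 0) else (if a = b + 1 then 1 else 0))"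
      if "a \<in> {1..d}" "b \<in> {1..d}" for a b
      unfolding A_def using that d by (subst entry) auto
    have "w = (\<lambda>_. 0)" if w: "w \<in> vecs d" "\<forall>a\<in>{1..d}. (\<Sum>b\<in>{1..d}. A (phi n y) a b * w b) = 0" for w
    proof (rule vecs_eqI[OF w(1)])
      show "(\<lambda>_. 0) \<in> vecs d" unfolding vecs_def by simp
      fix k assume k: "k \<in> {1..d}"
      show "w k = 0"
      proof (cases "k = d")
        case True
        have "(\<Sum>b\<in>{1..d}. A (phi n y) 1 b * w b) = (\<Sum>b\<in>{1..d}. if b = d then - w d else 0)"
          by (intro sum.cong refl) (use d in \<open>auto simp: A\<close>)
        then show ?thesis using w(2) True d by simp
      next
        case False
        have "(\<Sum>b\<in>{1..d}. A (phi n y) (k + 1) b * w b) = (\<Sum>b\<in>{1..d}. if b = k then w k else 0)"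
          by (intro sum.cong refl) (use k False in \<open>auto simp: A\<close>)
        moreover have "k + 1 \<in> {1..d}" using k False by auto
        ultimately show ?thesis using w(2) k by simp
      qed
    qed
    then show ?thesis unfolding f_def y_def[symmetric] fdet_eq_0_iff by blast
  qed
  ultimately show ?thesis by blast
qed

lemma phi_cut_mpoly: "(\<lambda>x. phi n (cut n N x) i j k) \<in> mpoly (params n)"
  using phi_mpoly[of n i j k]
proof (induction rule: mpoly.induct)
  case (mp_var v)
  show ?case
  proof (cases "key n v < N")
    case True
    then show ?thesis using mp_var mpoly.mp_var[of v "params n"] unfolding cut_def by simp
  next
    case False
    then show ?thesis using mp_const[of 0] unfolding cut_def by simp
  qed
qed (auto intro: mpoly.intros)

text \<open>The closed image of a coordinate subspace of the parameters, hence irreducible for the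
  same reason as \<open>CNil n\<close>.\<close>

definition stratum :: "nat \<Rightarrow> nat \<Rightarrow> sc set" where
  "stratum n N = zar_closure n (range (\<lambda>x. phi n (cut n N x)))"

lemma cut_range_ambient: "range (\<lambda>x. phi n (cut n N x)) \<subseteq> ambient n"
  using range_phi_ambient by blast

lemma stratum_closed: "zar_closed n (stratum n N)"
  unfolding stratum_def by (rule zar_closed_closure[OF cut_range_ambient])

lemma stratum_irreducible: "zar_irreducible n (stratum n N)"
  unfolding stratum_def by (rule zar_irreducible_image[OF phi_cut_mpoly cut_range_ambient])

lemma stratum_CNil: "stratum n N \<subseteq> CNil n"
  unfolding stratum_def by (rule zar_closure_minimal[OF CNil_closed]) (use phi_CNil in blast)

lemma stratum_mono: "N \<le> N' \<Longrightarrow> stratum n N \<subseteq> stratum n N'"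
proof -
  assume "N \<le> N'"
  then have "cut n N x = cut n N' (cut n N x)" for x unfolding cut_def by auto
  then have "range (\<lambda>x. phi n (cut n N x)) \<subseteq> range (\<lambda>x. phi n (cut n N' x))"
    by (metis (no_types, lifting) image_subsetI rangeI)
  then show ?thesis
    unfolding stratum_def
    by (intro zar_closure_minimal zar_closed_closure cut_range_ambient)
      (blast intro: subsetD[OF zar_closure_subset])
qed

lemma stratum_strict:
  assumes "v \<in> params n"
  shows "stratum n (key n v) \<subset> stratum n (Suc (key n v))"
proof -
  obtain k j i where v: "v = (k, j, i)" by (cases v)
  have "\<exists>g\<in>poly_fun n. (\<forall>x. g (phi n (cut n (key n v) x)) = 0) \<and>
    (\<exists>x. g (phi n (cut n (Suc (key n v)) x)) \<noteq> 0)"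
    using separate_tri_param[of k j i n] separate_upper_param[of k j n] assms
    unfolding v by (cases "i = 0") auto
  then obtain g x where g: "g \<in> poly_fun n" "\<forall>x. g (phi n (cut n (key n v) x)) = 0"
    "g (phi n (cut n (Suc (key n v)) x)) \<noteq> 0" by blast
  have "g c = 0" if "c \<in> stratum n (key n v)" for c
    using that g(1,2) unfolding stratum_def zar_closure_eq[OF cut_range_ambient] by blast
  moreover have "phi n (cut n (Suc (key n v)) x) \<in> stratum n (Suc (key n v))"
    unfolding stratum_def by (rule subsetD[OF zar_closure_subset]) (rule rangeI)
  ultimately show ?thesis using g(3) stratum_mono[of "key n v" "Suc (key n v)" n] by auto
qed

text \<open>The values of \<open>key\<close> have gaps. At an N that is no key the stratum does not
  change, so the length counts the keys below N; injectivity of \<open>key\<close> makes each step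
  release exactly one parameter.\<close>

lemma stratum_chain:
  "\<exists>Z. irr_chain n (CNil n) (card {v \<in> params n. key n v < N}) Z \<and>
    Z (card {v \<in> params n. key n v < N}) = stratum n N"
proof (induction N)
  case 0
  show ?case
    by (rule exI[of _ "\<lambda>_. stratum n 0"])
      (simp add: irr_chain_def stratum_closed stratum_irreducible stratum_CNil)
next
  case (Suc N)
  let ?V = "\<lambda>N. {v \<in> params n. key n v < N}"
  obtain Z where Z: "irr_chain n (CNil n) (card (?V N)) Z" "Z (card (?V N)) = stratum n N"
    using Suc.IH by blast
  show ?case
  proof (cases "\<exists>v\<in>params n. key n v = N")
    case False
    then have "?V (Suc N) = ?V N" "cut n (Suc N) = cut n N"
      unfolding cut_def by (auto simp: less_Suc_eq fun_eq_iff)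
    with Z show ?thesis unfolding stratum_def by (intro exI[of _ Z]) simp
  next
    case True
    then obtain v where v: "v \<in> params n" "key n v = N" by blast
    then have "?V (Suc N) = insert v (?V N)"
      using key_inj[of n] by (auto simp: less_Suc_eq inj_on_def)
    moreover have "v \<notin> ?V N" "finite (?V N)" using v(2) params_finite by auto
    ultimately have card: "card (?V (Suc N)) = Suc (card (?V N))" by simp
    let ?m = "card (?V N)" and ?Z = "Z(Suc (card (?V N)) := stratum n (Suc N))"
    have *: "irr_chain n (CNil n) (Suc ?m) ?Z"
      unfolding irr_chain_def
    proof (intro conjI allI impI)
      fix i assume i: "i \<le> Suc ?m"
      then consider "i = Suc ?m" | "i \<le> ?m" by linarith
      then show "zar_closed n (?Z i)" "zar_irreducible n (?Z i)" "?Z i \<subseteq> CNil n"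
        using Z(1) unfolding irr_chain_def
        by (cases; simp add: stratum_closed stratum_irreducible stratum_CNil)+
    next
      fix i assume "i < Suc ?m"
      then consider "i = ?m" | "i < ?m" by linarith
      then show "?Z i \<subset> ?Z (Suc i)"
      proof cases
        case 1
        then show ?thesis using stratum_strict[OF v(1)] Z(2) v(2) by simp
      next
        case 2
        then show ?thesis using Z(1) unfolding irr_chain_def by simp
      qed
    qed
    show ?thesis unfolding card by (rule exI[of _ ?Z], rule conjI[OF *]) simp
  qed
qed

theorem CNil_irreducible: "zar_irreducible n (CNil n)"
  unfolding CNil_closure by (rule zar_irreducible_image[OF phi_mpoly range_phi_ambient])

theorem CNil_dim: "zar_dim_is n (CNil n) (card (params n))"
proof -
  let ?N = "Suc (\<Sum>v\<in>params n. key n v)"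
  have "key n v < ?N" if "v \<in> params n" for v
    using member_le_sum[OF that, of "key n"] params_finite by (simp add: less_Suc_eq_le)
  then have "{v \<in> params n. key n v < ?N} = params n" by blast
  then have "\<exists>Z. irr_chain n (CNil n) (card (params n)) Z"
    using stratum_chain[of n ?N] by metis
  moreover have "m \<le> card (params n)" if "irr_chain n (CNil n) m Z" for m Z
    by (rule irr_chain_bound[OF phi_mpoly params_finite range_phi_ambient _ that])
      (simp add: CNil_closure)
  ultimately show ?thesis unfolding zar_dim_is_def by blast
qed

section \<open>Genericity of the family\<close>

lemma inv_pairI_mv:
  assumes "\<And>x. x \<in> vecs n \<Longrightarrow> mv n a (mv n b x) = x" "\<And>x. x \<in> vecs n \<Longrightarrow> mv n b (mv n a x) = x"
  shows "inv_pair n a b"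
proof -
  have *: "(\<Sum>l\<in>{1..n}. a i l * b l j) = (if i = j then 1 else 0)"
    if "\<And>x. x \<in> vecs n \<Longrightarrow> mv n a (mv n b x) = x" "i \<in> {1..n}" "j \<in> {1..n}" for a b i j
  proof -
    have "(\<Sum>l\<in>{1..n}. a i l * b l j) = mv n (mmul n a b) (unitv j) i"
      using that by (simp only: mv_unitv mmul_def)
    also have "\<dots> = unitv j i" using that(1)[OF unitv_vecs[OF that(3)]] by (simp add: mv_mmul)
    finally show ?thesis by (simp add: unitv_def)
  qed
  show ?thesis
    unfolding inv_pair_def using *[OF assms(1)] *[OF assms(2)] by blast
qed

lemma orbit_trans:
  assumes "inv_pair n g h" "inv_pair n g' h'" "t \<in> ambient n" "act n g' h' t = u"
  shows "act n g h t \<in> orbit n u"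
proof -
  have "act n g h t = act n (mmul n h' g) (mmul n h g') u"
    using act_inverse[OF assms(2,3)] unfolding assms(4)[symmetric] act_act[symmetric] by simp
  moreover have "inv_pair n (mmul n h' g) (mmul n h g')"
    by (rule inv_pairI_mv)
      (simp_all add: mv_mmul mv_vecs inv_pair_mv[OF assms(1)] inv_pair_mv[OF assms(2)]
        inv_pair_mv[OF inv_pair_commute[OF assms(1)]] inv_pair_mv[OF inv_pair_commute[OF assms(2)]])
  ultimately show ?thesis unfolding orbit_def by blast
qed

lemma tri_zero: "t \<in> tri n \<Longrightarrow> k \<le> max i j \<Longrightarrow> t i j k = 0"
  unfolding tri_def by blast

lemma tri_commute: "t \<in> tri n \<Longrightarrow> t i j k = t j i k"
  unfolding tri_def commutative_alg_def by blast

lemma amult_tri_sum: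
  assumes "t \<in> tri n" "k \<in> {1..n}"
  shows "amult n t x y k = (\<Sum>p\<in>{1..<k}. \<Sum>q\<in>{1..<k}. x p * y q * t p q k)"
proof -
  have "amult n t x y k = (\<Sum>p\<in>{1..n}. \<Sum>q\<in>{1..n}. x p * y q * t p q k)"
    using assms(2) unfolding amult_def by simp
  also have "\<dots> = (\<Sum>p\<in>{1..n}. \<Sum>q\<in>{1..<k}. x p * y q * t p q k)"
    using assms by (intro sum.cong sum.mono_neutral_right) (auto simp: tri_zero)
  also have "\<dots> = (\<Sum>p\<in>{1..<k}. \<Sum>q\<in>{1..<k}. x p * y q * t p q k)"
    using assms by (intro sum.mono_neutral_right) (auto simp: tri_zero intro!: sum.neutral)
  finally show ?thesis .
qed

text \<open>In coordinate j + 1 only indices up to j contribute, and y has just the entry y j among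
  these.\<close>

lemma amult_lead:
  assumes t: "t \<in> tri n" and y: "\<And>l. l < j \<Longrightarrow> y l = 0" and j: "1 \<le> j" "j + 1 \<le> n"
  shows "amult n t x y (j + 1) = (\<Sum>p\<in>{1..j}. x p * t p j (j + 1)) * y j"
proof -
  have "amult n t x y (j + 1) = (\<Sum>p\<in>{1..<j + 1}. \<Sum>q\<in>{1..<j + 1}. x p * y q * t p q (j + 1))"
    using j by (intro amult_tri_sum[OF t]) auto
  also have "\<dots> = (\<Sum>p\<in>{1..j}. x p * t p j (j + 1) * y j)"
  proof (rule sum.cong)
    fix p
    have "{1..<j + 1} = insert j {1..<j}" using j by auto
    then show "(\<Sum>q\<in>{1..<j + 1}. x p * y q * t p q (j + 1)) = x p * t p j (j + 1) * y j"
      using y by simp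
  qed auto
  finally show ?thesis by (simp add: sum_distrib_right)
qed

text \<open>Equation i is solved for \<xi> i. Fixing \<xi> 1 = 1 leaves only a common scale, later
  called r.\<close>

lemma triangular_system:
  fixes a :: "nat \<Rightarrow> nat \<Rightarrow> complex"
  assumes "\<And>i. i \<in> {2..m} \<Longrightarrow> a i i \<noteq> 0"
  shows "\<exists>\<xi>. \<xi> 1 = 1 \<and> (\<forall>i\<in>{2..m}. (\<Sum>j\<in>{1..i}. \<xi> j * a j i) = 0)"
  using assms
proof (induction m)
  case 0
  show ?case by (rule exI[of _ "\<lambda>_. 1"]) simp
next
  case (Suc m)
  then obtain \<xi> where \<xi>: "\<xi> 1 = 1" "\<And>i. i \<in> {2..m} \<Longrightarrow> (\<Sum>j\<in>{1..i}. \<xi> j * a j i) = 0"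
    by (auto simp: le_Suc_eq)
  show ?case
  proof (cases "2 \<le> Suc m")
    case False
    then show ?thesis using \<xi>(1) by (intro exI[of _ \<xi>]) simp
  next
    case True
    let ?\<eta> = "\<xi>(Suc m := - (\<Sum>j\<in>{1..m}. \<xi> j * a j (Suc m)) / a (Suc m) (Suc m))"
    have old: "(\<Sum>j\<in>{1..i}. ?\<eta> j * a j k) = (\<Sum>j\<in>{1..i}. \<xi> j * a j k)" if "i \<le> m" for i k
      using that by (intro sum.cong) auto
    have "(\<Sum>j\<in>{1..i}. ?\<eta> j * a j i) = 0" if i: "i \<in> {2..Suc m}" for i
    proof (cases "i \<le> m")
      case True
      then show ?thesis using old[OF True, of i] \<xi>(2)[of i] i by simp
    next
      case False
      then have "i = Suc m" using i by simp
      moreover have "a (Suc m) (Suc m) \<noteq> 0" using Suc.prems[of "Suc m"] True by simp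
      ultimately show ?thesis using old[of m "Suc m"] by simp
    qed
    moreover have "?\<eta> 1 = 1" using \<xi>(1) True by simp
    ultimately show ?thesis by blast
  qed
qed

text \<open>This is t 2 2 3 * t 3 3 4 * (t 1 2 4 + \<xi> 2 * t 2 2 4 + \<xi> 3 * t 2 3 4) after
  eliminating \<xi> 2 and \<xi> 3 by the equations for i = 2 and i = 3.\<close>

definition nondegA :: "sc \<Rightarrow> complex" where
  "nondegA t = t 1 2 4 * t 2 2 3 * t 3 3 4 - t 1 2 3 * t 2 2 4 * t 3 3 4
    - t 1 3 4 * t 2 2 3 * t 2 3 4 + t 1 2 3 * t 2 3 4 * t 2 3 4"

text \<open>This is t 2 2 3 * w for the w of \<open>S_fam_in_orbit\<close>, with \<xi> 2
  eliminated.\<close>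

definition nondegB :: "sc \<Rightarrow> complex" where
  "nondegB t = t 1 1 2 * t 2 2 3 * t 2 3 4 + (t 1 1 3 * t 2 2 3 - t 1 2 3 * t 1 2 3) * t 3 3 4"

definition nondeg :: "nat \<Rightarrow> sc \<Rightarrow> complex" where
  "nondeg n t = (\<Prod>i\<in>{1..n - 1}. t i i (i + 1)) * (nondegA t * nondegB t)"

text \<open>The new basis is \<open>b 1 = x\<close>, \<open>b (i + 1) = b i ^ 2\<close>. Up to a scalar \<open>r\<close>, the vector \<open>x\<close> is
  determined by the vanishing of the coefficient of \<open>b (i + 1)\<close> in \<open>b 1 * b i\<close>, which is a triangular
  linear system. The coefficient of \<open>b 4\<close> in \<open>b 2 * b 3\<close> scales with \<open>1 / r ^ 2\<close> and is thus made
  \<open>1\<close>; \<open>nondegB\<close> ensures that it is nonzero, and \<open>nondegA\<close> that the one in \<open>b 1 * b 2\<close> is.\<close>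
lemma S_fam_in_orbit:
  assumes n: "4 \<le> n" and t: "t \<in> tri n" and D: "nondeg n t \<noteq> 0"
  shows "\<exists>g h. inv_pair n g h \<and> act n g h t \<in> S_fam n"
proof -
  have diag: "t i i (i + 1) \<noteq> 0" if "i \<in> {1..n - 1}" for i
    using D that unfolding nondeg_def by auto
  have DA: "nondegA t \<noteq> 0" and DB: "nondegB t \<noteq> 0" using D unfolding nondeg_def by auto
  have d1: "t 1 1 2 \<noteq> 0" and d2: "t 2 2 3 \<noteq> 0" and d3: "t 3 3 4 \<noteq> 0"
    using diag[of 1] diag[of 2] diag[of 3] n by auto
  obtain \<xi> where \<xi>: "\<xi> 1 = 1" "\<And>i. i \<in> {2..n - 1} \<Longrightarrow> (\<Sum>j\<in>{1..i}. \<xi> j * t j i (i + 1)) = 0"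
    using triangular_system[of "n - 1" "\<lambda>j i. t j i (i + 1)"] diag by auto
  have sums: "{1..2} = {1, 2::nat}" "{1..3} = {1, 2, 3::nat}" "{1..<3} = {1, 2::nat}" "{1..<4} = {1, 2, 3::nat}"
    by auto
  have \<xi>2: "t 1 2 3 + \<xi> 2 * t 2 2 3 = 0"
    using \<xi>(2)[of 2] \<xi>(1) n by (simp add: sums)
  have \<xi>3: "t 1 3 4 + \<xi> 2 * t 2 3 4 + \<xi> 3 * t 3 3 4 = 0"
    using \<xi>(2)[of 3] \<xi>(1) n by (auto simp: sums add.assoc)
  \<comment> \<open>Up to the factor r * r, y3 is coordinate 3 of b 2, and w is the factor by which
    multiplication with b 2 takes the leading entry b 3 3 to coordinate 4.\<close>
  define y3 where "y3 = t 1 1 3 + 2 * \<xi> 2 * t 1 2 3 + \<xi> 2 * \<xi> 2 * t 2 2 3"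
  define w where "w = t 1 1 2 * t 2 3 4 + y3 * t 3 3 4"
  have y3: "t 2 2 3 * y3 = t 1 1 3 * t 2 2 3 - t 1 2 3 * t 1 2 3"
  proof -
    have e: "\<xi> 2 * t 2 2 3 = - t 1 2 3" using \<xi>2 by (simp add: add_eq_0_iff)
    have "t 2 2 3 * y3 = t 1 1 3 * t 2 2 3 + 2 * (\<xi> 2 * t 2 2 3) * t 1 2 3 + (\<xi> 2 * t 2 2 3) * (\<xi> 2 * t 2 2 3)"
      unfolding y3_def by (simp add: algebra_simps)
    then show ?thesis unfolding e by (simp add: algebra_simps)
  qed
  have "t 2 2 3 * w = t 1 1 2 * t 2 2 3 * t 2 3 4 + (t 2 2 3 * y3) * t 3 3 4"
    unfolding w_def by (simp add: algebra_simps)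
  then have "t 2 2 3 * w = nondegB t" unfolding y3 nondegB_def .
  then have w: "w \<noteq> 0" using DB by auto
  have wA: "t 2 2 3 * t 3 3 4 * (t 1 2 4 + \<xi> 2 * t 2 2 4 + \<xi> 3 * t 2 3 4) = nondegA t"
  proof -
    have e2: "\<xi> 2 * t 2 2 3 = - t 1 2 3" using \<xi>2 by (simp add: add_eq_0_iff)
    have e3: "\<xi> 3 * t 3 3 4 = - t 1 3 4 - \<xi> 2 * t 2 3 4" using \<xi>3 by (simp add: algebra_simps add_eq_0_iff)
    have "t 2 2 3 * t 3 3 4 * (t 1 2 4 + \<xi> 2 * t 2 2 4 + \<xi> 3 * t 2 3 4) =
      t 1 2 4 * t 2 2 3 * t 3 3 4 + (\<xi> 2 * t 2 2 3) * t 2 2 4 * t 3 3 4 + t 2 2 3 * (\<xi> 3 * t 3 3 4) * t 2 3 4"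
      by (simp add: algebra_simps)
    also have "\<dots> = t 1 2 4 * t 2 2 3 * t 3 3 4 + (\<xi> 2 * t 2 2 3) * t 2 2 4 * t 3 3 4
       - t 1 3 4 * t 2 2 3 * t 2 3 4 - (\<xi> 2 * t 2 2 3) * t 2 3 4 * t 2 3 4"
      unfolding e3 by (simp add: algebra_simps)
    also have "\<dots> = nondegA t" unfolding e2 nondegA_def by (simp add: algebra_simps)
    finally show ?thesis .
  qed
  \<comment> \<open>Coordinate 4 of b 2 * b 3 is r^2 * w * b 3 3, while b 4 4 = t 3 3 4 * b 3 3 * b
    3 3 with b 3 3 of degree 4 in r. Equating the two leaves this value for r^2.\<close>
  define r where "r = csqrt (w / (t 1 1 2 * t 1 1 2 * t 2 2 3 * t 3 3 4))"
  have rr: "r * r * (t 1 1 2 * t 1 1 2 * t 2 2 3 * t 3 3 4) = w"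
    using d1 d2 d3 power2_csqrt[of "w / (t 1 1 2 * t 1 1 2 * t 2 2 3 * t 3 3 4)"]
    unfolding r_def power2_eq_square by simp
  then have r: "r \<noteq> 0" using w by auto
  define b where "b i = ((\<lambda>v. amult n t v v) ^^ (i - 1)) (\<lambda>l. if l \<in> {1..n} then r * \<xi> l else 0)" for i
  have b1: "b 1 = (\<lambda>l. if l \<in> {1..n} then r * \<xi> l else 0)" unfolding b_def by simp
  have bS: "b (i + 1) = amult n t (b i) (b i)" if "1 \<le> i" for i
    using that unfolding b_def by (cases i) (simp_all del: atLeastAtMost_iff add: One_nat_def)
  have bv: "b i \<in> vecs n" if "1 \<le> i" for i
  proof (cases "i = 1")
    case True
    then show ?thesis unfolding b1 True vecs_def by simp
  next
    case False
    then show ?thesis using bS[of "i - 1"] that amult_vecs by simp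
  qed
  have b0: "l < i \<Longrightarrow> b i l = 0" if "1 \<le> i" for i l
    using that
  proof (induction i arbitrary: l rule: dec_induct)
    case base
    then show ?case by (simp add: b1)
  next
    case (step i)
    then show ?case
      using tri_amult_zero(1)[OF t, of i "b i" l "b i"] bS[of i] unfolding Suc_eq_plus1 by simp
  qed
  have bii: "b (i + 1) (i + 1) = t i i (i + 1) * b i i * b i i" if "i \<in> {1..n - 1}" for i
  proof -
    have "b (i + 1) (i + 1) = (\<Sum>p\<in>{1..i}. b i p * t p i (i + 1)) * b i i"
      using that bS[of i] b0[of i] amult_lead[OF t, of i "b i" "b i"] by auto
    also have "(\<Sum>p\<in>{1..i}. b i p * t p i (i + 1)) = (\<Sum>p\<in>{1..i}. if p = i then b i i * t i i (i + 1) else 0)"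
      using b0[of i] that by (intro sum.cong) auto
    also have "\<dots> = b i i * t i i (i + 1)" using that by simp
    finally show ?thesis by (simp add: algebra_simps)
  qed
  have bnz: "i \<le> n \<Longrightarrow> b i i \<noteq> 0" if "1 \<le> i" for i
    using that
  proof (induction i rule: dec_induct)
    case base
    then show ?case using r \<xi>(1) by (simp add: b1)
  next
    case (step i)
    then have "i \<in> {1..n - 1}" by simp
    with bii[of i] diag[of i] step show ?case unfolding Suc_eq_plus1 by simp
  qed
  define g where "g p i = b i p" for p i
  have g0: "g p i = 0" if "p \<in> {1..n}" "i \<in> {1..n}" "p < i" for p i
    unfolding g_def using b0 that by simp
  have "fdet n g \<noteq> 0"
  proof -
    have "det (fmat n g) = prod_list (diag_mat (fmat n g))"
      by (rule det_lower_triangular[OF _ fmat_carrier]) (auto simp: fmat_def g0)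
    moreover have "0 \<notin> set (diag_mat (fmat n g))"
      using bnz by (auto simp: diag_mat_def fmat_def g_def)
    ultimately show ?thesis unfolding fdet_def by (simp add: prod_list_zero_iff)
  qed
  then obtain h where gh: "inv_pair n g h" using inv_pairI_fdet by blast
  have hg: "(\<Sum>l\<in>{1..n}. h i l * g l j) = (if i = j then 1 else 0)" if "i \<in> {1..n}" "j \<in> {1..n}" for i j
    using gh that unfolding inv_pair_def by blast
  have h0: "h i l = 0" if "i \<in> {1..n}" "l \<in> {1..n}" "i < l" for i l
    by (rule inverse_lower[of 1 n g h, OF _ g0 hg that(2,1,3)]) simp_all
  have gu: "mv n g (unitv i) = b i" if "i \<in> {1..n}" for i
    by (rule vecs_eqI[OF mv_vecs bv]) (use that in \<open>simp_all add: mv_unitv g_def\<close>)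
  \<comment> \<open>As h is lower triangular, a leading coordinate is only rescaled, by h k k = 1 /
    b k k. Hence the constants of u needed below can be read off in the old coordinates.\<close>
  have hz: "mv n h z k = h k k * z k" if "k \<in> {1..n}" "\<And>l. l < k \<Longrightarrow> z l = 0" for z k
  proof -
    have "mv n h z k = (\<Sum>l\<in>{1..n}. if l = k then h k k * z k else 0)"
      using that(1) unfolding mv_def
      by (simp only: if_True, intro sum.cong refl) (use that h0 in \<open>metis (full_types) linorder_neqE_nat mult_zero_left mult_zero_right\<close>)
    then show ?thesis using that(1) by simp
  qed
  have hkk: "h k k * b k k = 1" if "k \<in> {1..n}" for k
  proof -
    have "mv n h (b k) k = h k k * b k k" using that b0[of k] by (intro hz) auto
    moreover have "mv n h (b k) = unitv k"
      using gu[OF that] inv_pair_mv[OF inv_pair_commute[OF gh] unitv_vecs[OF that]] by simp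
    ultimately show ?thesis by (simp add: unitv_def)
  qed
  define u where "u = act n g h t"
  have ut: "u \<in> tri n" unfolding u_def by (rule act_lower_tri[OF t g0 h0])
  have entry: "u i j k = mv n h (amult n t (b i) (b j)) k"
    if "i \<in> {1..n}" "j \<in> {1..n}" "k \<in> {1..n}" for i j k
    unfolding u_def using act_entry[OF that] gu[OF that(1)] gu[OF that(2)] by simp
  have squares: "u i i k = (if k = i + 1 then 1 else 0)" if i: "i \<in> {1..n - 1}" for i k
  proof (cases "k \<in> {1..n}")
    case True
    have i1: "i + 1 \<in> {1..n}" using i by auto
    have "u i i k = mv n h (mv n g (unitv (i + 1))) k"
      using i True bS[of i] gu[OF i1] by (subst entry) auto
    then show ?thesis
      using inv_pair_mv[OF inv_pair_commute[OF gh] unitv_vecs[OF i1]] by (simp add: unitv_def)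
  next
    case False
    then have "k \<noteq> i + 1" using i by auto
    moreover have "u i i k = 0" using False unfolding u_def act_def by auto
    ultimately show ?thesis by simp
  qed
  have z1: "amult n t (b 1) (b i) (i + 1) = 0" if i: "i \<in> {2..n - 1}" for i
  proof -
    have "amult n t (b 1) (b i) (i + 1) = (\<Sum>p\<in>{1..i}. b 1 p * t p i (i + 1)) * b i i"
      using i b0[of i] by (intro amult_lead[OF t]) auto
    also have "(\<Sum>p\<in>{1..i}. b 1 p * t p i (i + 1)) = r * (\<Sum>p\<in>{1..i}. \<xi> p * t p i (i + 1))"
      unfolding sum_distrib_left using i by (intro sum.cong) (auto simp: b1)
    finally show ?thesis using \<xi>(2)[OF i] by simp
  qed
  have u1: "u 1 i (i + 1) = 0" if i: "i \<in> {2..n - 1}" for i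
  proof -
    have in_n: "1 \<in> {1..n}" "i \<in> {1..n}" "i + 1 \<in> {1..n}" using i by auto
    have "amult n t (b 1) (b i) l = 0" if "l < i + 1" for l
      using tri_amult_zero(1)[OF t, of i "b i" l "b 1"] b0[of i] i that by auto
    then show ?thesis using entry[OF in_n] hz[OF in_n(3)] z1[OF i] by simp
  qed
  have in4: "1 \<in> {1..n}" "2 \<in> {1..n}" "3 \<in> {1..n}" "4 \<in> {1..n}" using n by auto
  have c1: "t 2 1 3 = t 1 2 3" "t 3 1 4 = t 1 3 4" "t 3 2 4 = t 2 3 4" "t 2 1 4 = t 1 2 4"
    using tri_commute[OF t] by blast+
  have bv1: "b 1 1 = r" "b 1 2 = r * \<xi> 2" "b 1 3 = r * \<xi> 3" using n \<xi>(1) by (auto simp: b1)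
  have b22: "b 2 2 = t 1 1 2 * r * r" using bii[of 1] n bv1 by simp
  have b23: "b 2 3 = r * r * y3"
    using bS[of 1] amult_tri_sum[OF t in4(3), of "b 1" "b 1"] unfolding y3_def
    by (simp add: sums bv1 c1 algebra_simps)
  have b21: "b 2 1 = 0" using b0[of 2 1] by simp
  have b33: "b 3 3 = t 2 2 3 * b 2 2 * b 2 2" using bii[of 2] n by simp
  have b44: "b 4 4 = t 3 3 4 * b 3 3 * b 3 3" using bii[of 3] n by simp
  have "amult n t (b 2) (b 3) 4 = (\<Sum>p\<in>{1..3}. b 2 p * t p 3 4) * b 3 3"
    using amult_lead[OF t, of 3 "b 3" "b 2"] b0[of 3] n by simp
  also have "\<dots> = r * r * w * b 3 3"
    unfolding w_def by (simp add: sums b21 b22 b23 algebra_simps)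
  also have "\<dots> = b 4 4" unfolding b44 rr[symmetric] b33 b22 by (simp add: algebra_simps)
  finally have z23: "amult n t (b 2) (b 3) 4 = b 4 4" .
  have "amult n t (b 2) (b 3) l = 0" if "l < 4" for l
    using tri_amult_zero(1)[OF t, of 3 "b 3" l "b 2"] b0[of 3] that by auto
  then have u23: "u 2 3 4 = 1" using entry[OF in4(2,3,4)] hz[OF in4(4)] z23 hkk[OF in4(4)] by simp
  have "amult n t (b 1) (b 2) 4 =
     b 2 2 * r * (t 1 2 4 + \<xi> 2 * t 2 2 4 + \<xi> 3 * t 2 3 4)
     + b 2 3 * r * (t 1 3 4 + \<xi> 2 * t 2 3 4 + \<xi> 3 * t 3 3 4)"
    unfolding amult_tri_sum[OF t in4(4)] by (simp add: sums bv1 b21 c1 algebra_simps)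
  \<comment> \<open>The bracket multiplying b 2 3 is the equation for i = 3. Coordinate 3 of b 1 * b
    2 vanishes by the equation for i = 2, which makes coordinate 4 the leading one.\<close>
  then have z12: "amult n t (b 1) (b 2) 4 = b 2 2 * r * (t 1 2 4 + \<xi> 2 * t 2 2 4 + \<xi> 3 * t 2 3 4)"
    unfolding \<xi>3 by simp
  have "amult n t (b 1) (b 2) l = 0" if "l < 4" for l
  proof (cases "l = 3")
    case True
    then show ?thesis using z1[of 2] n by simp
  next
    case False
    then show ?thesis using tri_amult_zero(1)[OF t, of 2 "b 2" l "b 1"] b0[of 2] that by auto
  qed
  then have "u 1 2 4 = h 4 4 * amult n t (b 1) (b 2) 4"
    using entry[OF in4(1,2,4)] hz[OF in4(4)] by simp
  moreover have "h 4 4 \<noteq> 0" using hkk[OF in4(4)] by auto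
  moreover have "b 2 2 \<noteq> 0" using bnz[of 2] n by simp
  ultimately have u12: "u 1 2 4 \<noteq> 0" using z12 wA DA r by auto
  have "u \<in> S_fam n"
    using ut squares u1 u12 u23 unfolding S_fam_def tri_def by blast
  then show ?thesis using gh unfolding u_def by blast
qed

text \<open>A point with \<open>nondeg n\<close> equal to 1 for n >= 4: c 1 2 4 and c 2 3 4 supply
  the first terms of \<open>nondegA\<close> and \<open>nondegB\<close>, and their other terms
  vanish.\<close>

definition model :: "nat \<Rightarrow> sc" where
  "model n = (\<lambda>i j k. if i = j \<and> k = i + 1 \<and> 1 \<le> i \<and> k \<le> n
     \<or> k = 4 \<and> k \<le> n \<and> (i, j) \<in> {(1, 2), (2, 1), (2, 3), (3, 2)} then 1 else 0)"

lemma model_tri: "model n \<in> tri n"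
  unfolding tri_def ambient_def commutative_alg_def model_def by auto

lemma model_nondeg: "4 \<le> n \<Longrightarrow> nondeg n (model n) \<noteq> 0"
  unfolding nondeg_def nondegA_def nondegB_def model_def by auto

lemma S_fam_tri: "S_fam n \<subseteq> tri n"
  unfolding S_fam_def tri_def by blast

text \<open>Here g and h stay fixed and only t moves, along the line inside \<open>tri n\<close>
  towards \<open>model n\<close>; almost every point of this line is nondegenerate.\<close>

theorem S_fam_generic:
  assumes "4 \<le> n"
  shows "generic n (S_fam n) (CNil n)"
proof -
  let ?X = "\<Union>c\<in>S_fam n. orbit n c"
  have X: "?X \<subseteq> CNil n" unfolding orbit_def using act_tri_CNil S_fam_tri by blast
  then have amb: "?X \<subseteq> ambient n" unfolding CNil_def by blast
  have "c \<in> zar_closure n ?X" if "c \<in> CNil n" for c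
  proof -
    obtain g h t where ght: "inv_pair n g h" "t \<in> tri n" "c = act n g h t"
      using CNil_act_tri[OF \<open>c \<in> CNil n\<close>] by blast
    define ts where "ts s = (\<lambda>i j k. t i j k + s * (model n i j k - t i j k))" for s
    have ts_tri: "ts s \<in> tri n" for s
      using ght(2) model_tri[of n] unfolding ts_def tri_def ambient_def commutative_alg_def by auto
    interpret fun_alg upoly by (rule fun_alg_upoly)
    have ts: "(\<lambda>s. ts s i j k) \<in> upoly" for i j k
      unfolding ts_def by (intro add mult const upoly_id)
    have nd: "(\<lambda>s. nondeg n (ts s)) \<in> upoly"
      unfolding nondeg_def nondegA_def nondegB_def by (intro prod add mult diff ts)
    have act_ts: "(\<lambda>s. act n g h (ts s) i j k) \<in> upoly" for i j k
      by (rule act[OF const const ts])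
    have ts01: "ts 0 = t" "ts 1 = model n" unfolding ts_def by simp_all
    have "f c = 0" if f: "f \<in> poly_fun n" "\<forall>x\<in>?X. f x = 0" for f
    proof (rule ccontr)
      assume "f c \<noteq> 0"
      then have f0: "f (act n g h (ts 0)) \<noteq> 0" unfolding ts01 ght(3) .
      have nd1: "nondeg n (ts 1) \<noteq> 0" unfolding ts01 by (rule model_nondeg[OF assms])
      obtain s where s: "nondeg n (ts s) \<noteq> 0" "f (act n g h (ts s)) \<noteq> 0"
        by (rule upoly_no_zero_divisors[OF nd
              poly_fun_comp[OF f(1), of "\<lambda>s. act n g h (ts s)", OF act_ts] nd1 f0])
      obtain g' h' where "inv_pair n g' h'" "act n g' h' (ts s) \<in> S_fam n"
        using S_fam_in_orbit[OF assms ts_tri s(1)] by blast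
      then have "act n g h (ts s) \<in> ?X"
        using orbit_trans[OF ght(1), of g' h' "ts s"] ts_tri[of s] unfolding tri_def by blast
      with f(2) s(2) show False by blast
    qed
    moreover have "c \<in> ambient n" using \<open>c \<in> CNil n\<close> unfolding CNil_def by blast
    ultimately show ?thesis unfolding zar_closure_eq[OF amb] by blast
  qed
  then show ?thesis
    unfolding generic_def using zar_closure_minimal[OF CNil_closed X] by blast
qed

theorem theoremB:
  shows "(\<forall>n\<ge>4. generic n (S_fam n) (CNil n)) \<and>
         (\<forall>n\<ge>2. zar_irreducible n (CNil n) \<and> zar_dim_is n (CNil n) (n * (n - 1) * (n + 4) div 6))"
  using S_fam_generic CNil_irreducible CNil_dim unfolding params_card by blast

end
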